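(* Let $t$ be a fixed constant. There is an algorithm running in time $2^{O(k)}\cdot\mathrm{poly}(n)$ that, given an instance $(U,\mathcal{S})$ of \textsc{$t$-Uniform Set Cover} with $|U|=n$ and an integer parameter $k$, determines whether there exists a set cover of size at most $\lceil n/t\rceil - k$, i.e. sets $S_1,\dots,S_m\in\mathcal{S}$ with $m\le \lceil n/t\rceil-k$ and $S_1\cup\dots\cup S_m=U$.
   Context: An instance of \textsc{$t$-Uniform Set Cover} is a finite universe $U$ together with a family $\mathcal{S}\subseteq 2^U$ of subsets of $U$ satisfying $\{A\subseteq U : |A|=t\}\subseteq \mathcal{S}$. *)

theory Defs
  imports Complex_Main "HOL-Library.Log_Nat"
begin

section \<open>Set covers of \<open>t\<close>-uniform instances\<close>

definition uniform_set_cover_instance :: "nat \<Rightarrow> 'a set \<Rightarrow> 'a set set \<Rightarrow> bool" where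
  "uniform_set_cover_instance t U S \<longleftrightarrow>
     finite U \<and> S \<subseteq> Pow U \<and> {A. A \<subseteq> U \<and> card A = t} \<subseteq> S"

text \<open>The bound \<open>b\<close> is an integer, as \<open>\<lceil>n/t\<rceil> - k\<close> may be negative (and then there is no cover).\<close>

definition has_set_cover_at_most :: "'a set \<Rightarrow> 'a set set \<Rightarrow> int \<Rightarrow> bool" where
  "has_set_cover_at_most U S b \<longleftrightarrow>
     (\<exists>As. set As \<subseteq> S \<and> int (length As) \<le> b \<and> \<Union> (set As) = U)"


section \<open>Model of computation\<close>

text \<open>
  Algorithms are programs of a first-order call-by-value language on binary trees with integer
  leaves, given as a deep embedding with a big-step semantics that counts steps. Trees are
  immutable, so moving or sharing one costs a single step. Integers are unbounded, and each
  arithmetic operation or comparison is charged by the bit lengths of its operands (logarithmic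
  cost); the model is therefore polynomially equivalent to Turing machines.
\<close>

datatype val = VInt int | VNil | VCons val val

text \<open>
  Variables are de Bruijn indices into an environment. \<open>ECase e e1 e2\<close> evaluates \<open>e1\<close> if \<open>e\<close>
  yields the empty tree, and \<open>e2\<close> with head (index 0) and tail (index 1) pushed if it yields a pair;
  \<open>EIfLe a b e1 e2\<close> evaluates \<open>e1\<close> if \<open>a \<le> b\<close> and \<open>e2\<close> otherwise.
\<close>

datatype expr =
    EVar nat
  | EInt int
  | EAdd expr expr
  | ESub expr expr
  | EMul expr expr
  | EIfLe expr expr expr expr
  | ENil
  | ECons expr expr
  | ECase expr expr expr
  | ELet expr expr
  | ECall nat "expr list"

text \<open>A program is the list of its function bodies; a call \<open>ECall f es\<close> runs body number \<open>f\<close> in the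
  environment consisting of the argument values, and execution starts with body 0.\<close>

type_synonym program = "expr list"

definition bits :: "int \<Rightarrow> nat" where
  "bits a = floorlog 2 (nat \<bar>a\<bar>)"

text \<open>\<open>eval P env e v c\<close>: in program \<open>P\<close>, the expression \<open>e\<close> evaluates to \<open>v\<close> in \<open>c\<close> steps.
  Nonterminating and ill-typed evaluations have no derivation.\<close>

inductive eval :: "program \<Rightarrow> val list \<Rightarrow> expr \<Rightarrow> val \<Rightarrow> nat \<Rightarrow> bool"
  and evals :: "program \<Rightarrow> val list \<Rightarrow> expr list \<Rightarrow> val list \<Rightarrow> nat \<Rightarrow> bool"
  for P :: program
where
  Var: "i < length env \<Longrightarrow> eval P env (EVar i) (env ! i) 1"
| Int: "eval P env (EInt a) (VInt a) 1"
| Add: "eval P env e1 (VInt a) c1 \<Longrightarrow> eval P env e2 (VInt b) c2 \<Longrightarrow>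
    eval P env (EAdd e1 e2) (VInt (a + b)) (c1 + c2 + 1 + bits a + bits b)"
| Sub: "eval P env e1 (VInt a) c1 \<Longrightarrow> eval P env e2 (VInt b) c2 \<Longrightarrow>
    eval P env (ESub e1 e2) (VInt (a - b)) (c1 + c2 + 1 + bits a + bits b)"
| Mul: "eval P env e1 (VInt a) c1 \<Longrightarrow> eval P env e2 (VInt b) c2 \<Longrightarrow>
    eval P env (EMul e1 e2) (VInt (a * b)) (c1 + c2 + (1 + bits a) * (1 + bits b))"
| IfLe_True: "eval P env e1 (VInt a) c1 \<Longrightarrow> eval P env e2 (VInt b) c2 \<Longrightarrow> a \<le> b \<Longrightarrow>
    eval P env e3 v c3 \<Longrightarrow>
    eval P env (EIfLe e1 e2 e3 e4) v (c1 + c2 + 1 + bits a + bits b + c3)"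
| IfLe_False: "eval P env e1 (VInt a) c1 \<Longrightarrow> eval P env e2 (VInt b) c2 \<Longrightarrow> \<not> a \<le> b \<Longrightarrow>
    eval P env e4 v c4 \<Longrightarrow>
    eval P env (EIfLe e1 e2 e3 e4) v (c1 + c2 + 1 + bits a + bits b + c4)"
| Nil: "eval P env ENil VNil 1"
| Cons: "eval P env e1 v1 c1 \<Longrightarrow> eval P env e2 v2 c2 \<Longrightarrow>
    eval P env (ECons e1 e2) (VCons v1 v2) (c1 + c2 + 1)"
| Case_Nil: "eval P env e VNil c \<Longrightarrow> eval P env e1 v c1 \<Longrightarrow>
    eval P env (ECase e e1 e2) v (c + 1 + c1)"
| Case_Cons: "eval P env e (VCons x y) c \<Longrightarrow> eval P (x # y # env) e2 v c2 \<Longrightarrow>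
    eval P env (ECase e e1 e2) v (c + 1 + c2)"
| Let: "eval P env e1 v1 c1 \<Longrightarrow> eval P (v1 # env) e2 v c2 \<Longrightarrow>
    eval P env (ELet e1 e2) v (c1 + 1 + c2)"
| Call: "evals P env es vs c1 \<Longrightarrow> f < length P \<Longrightarrow> eval P vs (P ! f) v c2 \<Longrightarrow>
    eval P env (ECall f es) v (c1 + 1 + c2)"
| Args_Nil: "evals P env [] [] 0"
| Args_Cons: "eval P env e v c \<Longrightarrow> evals P env es vs c' \<Longrightarrow>
    evals P env (e # es) (v # vs) (c + c')"

inductive_cases eval_elims:
  "eval P env (EVar i) v c"
  "eval P env (EInt a) v c"
  "eval P env (EAdd e1 e2) v c"
  "eval P env (ESub e1 e2) v c"
  "eval P env (EMul e1 e2) v c"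
  "eval P env (EIfLe e1 e2 e3 e4) v c"
  "eval P env ENil v c"
  "eval P env (ECons e1 e2) v c"
  "eval P env (ECase e e1 e2) v c"
  "eval P env (ELet e1 e2) v c"
  "eval P env (ECall f es) v c"
  "evals P env [] vs c"
  "evals P env (e # es) vs c"

lemma eval_deterministic:
  "eval P env e v c \<Longrightarrow> (\<And>v' c'. eval P env e v' c' \<Longrightarrow> v' = v \<and> c' = c)"
  "evals P env es vs c \<Longrightarrow> (\<And>vs' c'. evals P env es vs' c' \<Longrightarrow> vs' = vs \<and> c' = c)"
proof (induction rule: eval_evals.inducts)
  case Var
  from Var.prems show ?case by (rule eval_elims) auto
next
  case Int
  from Int.prems show ?case by (rule eval_elims) auto
next
  case Add
  from Add.prems show ?case by (rule eval_elims) (auto dest!: Add.IH(2,4))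
next
  case Sub
  from Sub.prems show ?case by (rule eval_elims) (auto dest!: Sub.IH(2,4))
next
  case Mul
  from Mul.prems show ?case by (rule eval_elims) (auto dest!: Mul.IH(2,4))
next
  case IfLe_True
  from IfLe_True.prems show ?case by (rule eval_elims) (auto dest!: IfLe_True.IH(2,4,6) simp: IfLe_True.hyps)
next
  case IfLe_False
  from IfLe_False.prems show ?case by (rule eval_elims) (auto dest!: IfLe_False.IH(2,4,6) simp: IfLe_False.hyps)
next
  case Nil
  from Nil.prems show ?case by (rule eval_elims) auto
next
  case Cons
  from Cons.prems show ?case by (rule eval_elims) (auto dest!: Cons.IH(2,4))
next
  case Case_Nil
  from Case_Nil.prems show ?case by (rule eval_elims) (auto dest!: Case_Nil.IH(2,4))
next
  case Case_Cons
  from Case_Cons.prems show ?case by (rule eval_elims) (auto dest!: Case_Cons.IH(2,4))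
next
  case Let
  from Let.prems show ?case by (rule eval_elims) (auto dest!: Let.IH(2,4))
next
  case Call
  from Call.prems show ?case by (rule eval_elims) (auto dest!: Call.IH(2,5))
next
  case Args_Nil
  from Args_Nil.prems show ?case by (rule eval_elims) auto
next
  case Args_Cons
  from Args_Cons.prems show ?case by (rule eval_elims) (auto dest!: Args_Cons.IH(2,4))
qed

definition runs_within :: "program \<Rightarrow> val \<Rightarrow> val \<Rightarrow> nat \<Rightarrow> bool" where
  "runs_within P x y T \<longleftrightarrow> (\<exists>c\<le>T. eval P [x] (ECall 0 [EVar 0]) y c)"


section \<open>Encoding of inputs and outputs\<close>

fun list_val :: "val list \<Rightarrow> val" where
  "list_val [] = VNil"
| "list_val (x # xs) = VCons x (list_val xs)"

definition bool_val :: "bool \<Rightarrow> val" where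
  "bool_val b = VInt (of_bool b)"

text \<open>The universe is enumerated by \<open>us\<close> and the family by \<open>As\<close>; the input consists of \<open>k\<close>, \<open>n\<close> and the
  incidence matrix, with one row of \<open>n\<close> bits per member of the family.\<close>

definition encode_input :: "'a list \<Rightarrow> 'a set list \<Rightarrow> int \<Rightarrow> val" where
  "encode_input us As k =
     list_val [VInt k, VInt (int (length us)),
       list_val (map (\<lambda>A. list_val (map (\<lambda>u. bool_val (u \<in> A)) us)) As)]"

text \<open>Both enumerations are arbitrary but free of repetitions. The latter matters for \<open>As\<close>: the family may
  have up to \<open>2 ^ n\<close> members, and running times are measured in \<open>n\<close> and \<open>k\<close> only, so that an
  algorithm need not have time to read its whole input.\<close>

definition enumerates :: "'a list \<Rightarrow> 'a set \<Rightarrow> bool" where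
  "enumerates xs X \<longleftrightarrow> distinct xs \<and> set xs = X"

end

theory Submission
  imports Defs "HOL-Computational_Algebra.Polynomial"
begin

text \<open>
  Write \<open>q = \<lceil>n/t\<rceil>\<close> and \<open>D = t * k - (t * q - n)\<close>. For \<open>k \<ge> 1\<close>, filling up with \<open>t\<close>-sets shows that a cover
  of size \<open>q - k\<close> exists iff some \<open>m\<close> members of the family have a union of at least \<open>t * m + D\<close>
  elements. In a smallest such collection every member has more than \<open>t\<close> private elements, and any
  \<open>D\<close> sets with that property already suffice; hence only \<open>m \<le> D\<close> matters, and the unions to be
  found have size \<open>O(k)\<close> for fixed \<open>t\<close>. If there is no such collection, then a maximal sequence of
  sets with more than \<open>t\<close> new elements each has a union \<open>W\<close> of size \<open>O(k)\<close> outside of which every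
  member of the family has at most \<open>t\<close> elements, so the family has at most \<open>2 ^ O(k) * (n + 1) ^ t\<close>
  members. A longer input can therefore be accepted without reading it to the end.
  For \<open>k \<le> 0\<close> there is a cover except possibly if \<open>0 < n < t\<close>, and then the size of the family is
  bounded in terms of \<open>t\<close>.

  Whether some \<open>m\<close> sets have a union of at least \<open>K\<close> elements is decided deterministically in time
  \<open>2 ^ O(K) * poly\<close> by computing in the tensor square of the exterior algebra of \<open>\<int>\<^sup>K\<close>. The element \<open>x\<close>
  acts by wedging with \<open>v \<otimes> v\<close> for the Vandermonde vector \<open>v\<close> of \<open>x\<close>, and the
  sum over all choices of \<open>m\<close> sets and of elements from them has as its top coefficient a sum of
  squared determinants, each nonzero iff its \<open>K\<close> chosen elements are distinct. Squares cannot cancel.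
\<close>

section \<open>The exterior algebra and Vandermonde vectors\<close>

text \<open>An element of the exterior algebra of \<open>\<int>\<^sup>d\<close> is given by its coefficients, indexed by bit lists of
  length \<open>d\<close> that encode sets of basis vectors. With \<open>g = g0 + e \<and> g1\<close> for the first basis vector \<open>e\<close>,
  the product is \<open>(c e + v) \<and> g = v \<and> g0 + e \<and> (c g0 - v \<and> g1)\<close>.\<close>

fun wedge :: "int list \<Rightarrow> (bool list \<Rightarrow> int) \<Rightarrow> bool list \<Rightarrow> int" where
  "wedge (c # v) g (False # b) = wedge v (\<lambda>r. g (False # r)) b"
| "wedge (c # v) g (True # b) = c * g (False # b) - wedge v (\<lambda>r. g (True # r)) b"
| "wedge _ _ _ = 0"

text \<open>A function on bit lists stands for an algebra element only through its values at lists
  of the right length, so agreement is required there only.\<close>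

lemma wedge_cong:
  "length v = length b \<Longrightarrow> (\<And>r. length r = length b \<Longrightarrow> g r = g' r) \<Longrightarrow> wedge v g b = wedge v g' b"
proof (induction b arbitrary: v g g')
  case (Cons x b)
  obtain c v' where v: "v = c # v'" "length v' = length b"
    using Cons.prems(1) by (auto simp: length_Suc_conv)
  have "wedge v' (\<lambda>r. g (y # r)) b = wedge v' (\<lambda>r. g' (y # r)) b" for y
    by (rule Cons.IH[OF v(2)], rule Cons.prems(2)) simp
  moreover have "g (False # b) = g' (False # b)"
    by (rule Cons.prems(2)) simp
  ultimately show ?case by (cases x) (simp_all add: v(1))
qed simp

lemma wedge_zero [simp]: "wedge v (\<lambda>_. 0) b = 0"
proof (induction b arbitrary: v)
  case (Cons x b)
  then show ?case by (cases v; cases x) simp_all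
qed simp

lemma wedge_add: "wedge v (\<lambda>r. f r + g r) b = wedge v f b + wedge v g b"
proof (induction v f b arbitrary: g rule: wedge.induct)
  case (1 c v f b)
  then show ?case using "1.IH"[of "\<lambda>r. g (False # r)"] by simp
next
  case (2 c v f b)
  then show ?case using "2.IH"[of "\<lambda>r. g (True # r)"] by (simp add: algebra_simps)
qed auto

lemma wedge_cmult: "wedge v (\<lambda>r. a * g r) b = a * wedge v g b"
  by (induction v g b rule: wedge.induct) (auto simp: algebra_simps)

lemma wedge_mult_right: "wedge v (\<lambda>r. g r * a) b = wedge v g b * a"
  using wedge_cmult[of v a g b] by (simp add: mult.commute)

lemma wedge_uminus: "wedge v (\<lambda>r. - g r) b = - wedge v g b"
  using wedge_cmult[of v "-1" g b] by simp

lemma wedge_diff: "wedge v (\<lambda>r. f r - g r) b = wedge v f b - wedge v g b"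
  using wedge_add[of v f "\<lambda>r. - g r" b] by (simp add: wedge_uminus)

lemma wedge_sum_list: "wedge v (\<lambda>r. \<Sum>x\<leftarrow>xs. f x r) b = (\<Sum>x\<leftarrow>xs. wedge v (f x) b)"
  by (induction xs) (simp_all add: wedge_add)

text \<open>With the first coordinates split off as \<open>c\<close> and \<open>d\<close>, the mixed
  terms \<open>c * (w' \<and> g0)\<close> and \<open>d * (v' \<and> g0)\<close> already occur with
  opposite signs in the two orders; the term with both tails is the induction hypothesis.\<close>

lemma wedge_anticommute:
  "length v = length b \<Longrightarrow> length w = length b \<Longrightarrow>
   wedge v (wedge w g) b = - wedge w (wedge v g) b"
proof (induction b arbitrary: v w g)
  case (Cons x b)
  obtain c v' d w' where [simp]: "v = c # v'" "w = d # w'"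
    using Cons.prems by (metis length_Suc_conv)
  show ?case
    using Cons.prems by (cases x) (simp_all add: Cons.IH[of v' w'] wedge_diff wedge_cmult)
qed simp

lemma wedge_twice: "length v = length b \<Longrightarrow> wedge v (wedge v g) b = 0"
  using wedge_anticommute[of v b v g] by simp

text \<open>A sign arises only when a vector passes a basis vector in front of it. The padded
  coordinates come last and are zero, so the remaining bits are carried along as mere
  parameters.\<close>

lemma wedge_append_zeros:
  "length v \<le> length b \<Longrightarrow>
   wedge (v @ replicate k 0) g b = wedge v (\<lambda>a. g (a @ drop (length v) b)) (take (length v) b)"
proof (induction v arbitrary: g b)
  case Nil
  have "wedge (replicate k 0) g b = 0" for g b
  proof (induction b arbitrary: k g)
    case (Cons x b)
    then show ?case by (cases k; cases x) simp_all
  qed (cases k; simp)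
  then show ?case by simp
next
  case (Cons c v)
  then obtain x b' where "b = x # b'" by (cases b) auto
  with Cons show ?case by (cases x) simp_all
qed

lemma wedge_degree:
  assumes "length v = length b" "\<And>r. length r = length b \<Longrightarrow> j \<le> count_list r True \<Longrightarrow> g r = 0"
    and "Suc j \<le> count_list b True"
  shows "wedge v g b = 0"
  using assms
proof (induction v g b arbitrary: j rule: wedge.induct)
  case (1 c v g b)
  have "wedge v (\<lambda>r. g (False # r)) b = 0"
    by (rule "1.IH"[of j]) (use 1 in auto)
  then show ?case by simp
next
  case (2 c v g b)
  have "wedge v (\<lambda>r. g (True # r)) b = 0"
  \<comment> \<open>For \<open>j = 0\<close> the hypothesis makes \<open>g\<close> vanish
    altogether; otherwise stripping the leading \<open>True\<close> lowers both degrees by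
    one.\<close>
  proof (cases j)
    case 0
    have "wedge v (\<lambda>r. g (True # r)) b = wedge v (\<lambda>_. 0) b"
      by (rule wedge_cong) (use 2 0 in auto)
    then show ?thesis by simp
  next
    case (Suc i)
    show ?thesis by (rule "2.IH"[of i]) (use 2 Suc in auto)
  qed
  with 2 show ?case by simp
qed (simp_all (no_asm))

text \<open>A coefficient of the product collects at most one coefficient of \<open>g\<close>, up to
  sign, per coordinate of \<open>v\<close>. This will control the bit lengths of all integers in the
  program.\<close>

lemma wedge_bound:
  assumes "length v = length b" "\<And>r. length r = length b \<Longrightarrow> \<bar>g r\<bar> \<le> M"
  shows "\<bar>wedge v g b\<bar> \<le> (\<Sum>x\<leftarrow>v. \<bar>x\<bar>) * M"
  using assms
proof (induction v g b rule: wedge.induct)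
  case (1 c v g b)
  have M: "0 \<le> M" using "1.prems"(2)[of "True # b"] by simp
  have "\<bar>wedge v (\<lambda>r. g (False # r)) b\<bar> \<le> (\<Sum>x\<leftarrow>v. \<bar>x\<bar>) * M"
    using 1 by simp
  then show ?case using M by (simp add: algebra_simps add_increasing)
next
  case (2 c v g b)
  have "\<bar>wedge v (\<lambda>r. g (True # r)) b\<bar> \<le> (\<Sum>x\<leftarrow>v. \<bar>x\<bar>) * M"
    using 2 by simp
  moreover have "\<bar>c * g (False # b)\<bar> \<le> \<bar>c\<bar> * M"
    using 2 by (simp add: abs_mult mult_left_mono)
  ultimately show ?case by (simp add: algebra_simps)
next
  case ("3_1" g b)
  from "3_1"(1) show ?case by simp
next
  case ("3_2" v g)
  from "3_2"(1) show ?case by simp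
qed (simp_all (no_asm))

text \<open>The Vandermonde vector with the highest power first: its tail is the Vandermonde vector
  of length one less, which fits the recursion of \<open>wedge\<close> on the first
  coordinate.\<close>

fun dpowers :: "nat \<Rightarrow> int \<Rightarrow> int list" where
  "dpowers 0 x = []"
| "dpowers (Suc k) x = x ^ k # dpowers k x"

lemma length_dpowers [simp]: "length (dpowers k x) = k"
  by (induction k) auto

text \<open>The exterior product of the Vandermonde vectors of \<open>xs\<close>. For
  \<open>k\<close> points its coefficient at the all-\<open>True\<close> list is a Vandermonde
  determinant.\<close>

fun ext_prod :: "nat \<Rightarrow> int list \<Rightarrow> bool list \<Rightarrow> int" where
  "ext_prod k [] b = of_bool (True \<notin> set b)"
| "ext_prod k (x # xs) b = wedge (dpowers k x) (ext_prod k xs) b"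

lemma ext_prod_Cons [simp]: "ext_prod k (x # xs) = wedge (dpowers k x) (ext_prod k xs)"
  by (rule ext) simp

declare ext_prod.simps(2) [simp del]

text \<open>Anticommutation moves \<open>x\<close> past the other factors until it meets its copy,
  where \<open>wedge_twice\<close> applies.\<close>

lemma ext_prod_Cons_member: "x \<in> set xs \<Longrightarrow> length b = k \<Longrightarrow> ext_prod k (x # xs) b = 0"
proof (induction xs arbitrary: b)
  case (Cons y xs)
  show ?case
  proof (cases "x = y")
    case True
    then show ?thesis using Cons.prems by (simp add: wedge_twice)
  next
    case False
    have "ext_prod k (x # y # xs) b = - wedge (dpowers k y) (wedge (dpowers k x) (ext_prod k xs)) b"
      using Cons.prems by (simp add: wedge_anticommute[of "dpowers k x"])
    also have "wedge (dpowers k y) (wedge (dpowers k x) (ext_prod k xs)) b = wedge (dpowers k y) (\<lambda>_. 0) b"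
      by (rule wedge_cong) (use Cons False in auto)
    finally show ?thesis by simp
  qed
qed simp

lemma ext_prod_not_distinct: "\<not> distinct xs \<Longrightarrow> length b = k \<Longrightarrow> ext_prod k xs b = 0"
proof (induction xs arbitrary: b)
  case (Cons x xs)
  show ?case
  proof (cases "x \<in> set xs")
    case True
    then show ?thesis using Cons.prems(2) by (rule ext_prod_Cons_member)
  next
    case False
    have "wedge (dpowers k x) (ext_prod k xs) b = wedge (dpowers k x) (\<lambda>_. 0) b"
      by (rule wedge_cong) (use Cons False in auto)
    then show ?thesis by simp
  qed
qed simp

lemma ext_prod_degree: "length b = k \<Longrightarrow> length xs < count_list b True \<Longrightarrow> ext_prod k xs b = 0"
proof (induction xs arbitrary: b)
  case Nil
  then show ?case by (cases "True \<in> set b") simp_all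
next
  case (Cons x xs)
  show ?case
    unfolding ext_prod_Cons
  proof (rule wedge_degree[where j = "Suc (length xs)"])
    show "ext_prod k xs r = 0" if "length r = length b" "Suc (length xs) \<le> count_list r True" for r
      by (rule Cons.IH) (use that Cons.prems(1) in simp_all)
    show "Suc (Suc (length xs)) \<le> count_list b True" using Cons.prems(2) by simp
  qed (use Cons.prems(1) in simp)
qed

text \<open>The product is linear in the vector, whose entries are powers of \<open>x\<close> with
  exponent below \<open>k\<close>. This allows counting roots in
  \<open>ext_prod_top_nonzero\<close>.\<close>

lemma wedge_dpowers_poly:
  assumes "length b = k"
  shows "\<exists>p. (\<forall>x. wedge (dpowers k x) g b = poly p x) \<and> degree p \<le> k - 1"
  using assms
proof (induction k arbitrary: b g)
  case 0
  then show ?case by (intro exI[of _ 0]) simp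
next
  case (Suc k)
  then obtain a b' where b: "b = a # b'" by (cases b) auto
  show ?case
  proof (cases a)
    case False
    from Suc.IH[of b' "\<lambda>r. g (False # r)"] Suc.prems b obtain p
      where "\<forall>x. wedge (dpowers k x) (\<lambda>r. g (False # r)) b' = poly p x" "degree p \<le> k - 1" by auto
    then show ?thesis using False b by (intro exI[of _ p]) auto
  next
    case True
    from Suc.IH[of b' "\<lambda>r. g (True # r)"] Suc.prems b obtain p
      where p: "\<forall>x. wedge (dpowers k x) (\<lambda>r. g (True # r)) b' = poly p x" "degree p \<le> k - 1" by auto
    show ?thesis
      using True b p
      by (intro exI[of _ "monom (g (False # b')) k - p"])
         (auto simp: poly_monom intro!: degree_diff_le degree_monom_le)
  qed
qed

text \<open>Coefficients that avoid the first basis vector do not see the first coordinates, and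
  what remains of each vector is the shorter Vandermonde vector.\<close>

lemma ext_prod_False: "ext_prod (Suc k) xs (False # b) = ext_prod k xs b"
proof (induction xs arbitrary: b)
  case (Cons x xs)
  then show ?case by simp
qed simp

text \<open>Seen as a function of its first point, the Vandermonde determinant is a polynomial whose
  leading coefficient is a smaller Vandermonde determinant and which vanishes at the other points.\<close>

lemma ext_prod_top_nonzero:
  "distinct xs \<Longrightarrow> ext_prod (length xs) xs (replicate (length xs) True) \<noteq> 0"
proof (induction xs)
  case (Cons x xs)
  define k where "k = length xs"
  define top where "top = replicate k True"
  define c where "c = ext_prod k xs top"
  have c: "c \<noteq> 0" using Cons by (simp add: c_def k_def top_def)
  obtain q where q: "\<And>y. wedge (dpowers k y) (\<lambda>r. ext_prod (Suc k) xs (True # r)) top = poly q y"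
    "degree q \<le> k - 1"
    using wedge_dpowers_poly[of top k "\<lambda>r. ext_prod (Suc k) xs (True # r)"]
    by (auto simp: top_def)
  define p where "p = monom c k - q"
  have p: "ext_prod (Suc k) (y # xs) (True # top) = poly p y" for y
    by (simp add: p_def poly_monom q(1) ext_prod_False c_def)
  have "p \<noteq> 0 \<and> degree p \<le> k"
  \<comment> \<open>For \<open>k = 0\<close> the truncated bound \<open>k - 1\<close> no longer
    forces the coefficient of \<open>q\<close> at \<open>k\<close> to vanish, but then
    \<open>q\<close> is the zero polynomial.\<close>
  proof (cases "k = 0")
    case True
    then have "q = 0" using q(1) [of 0] q(2) by (auto elim!: degree_eq_zeroE)
    then show ?thesis using True c by (simp add: p_def monom_0)
  next
    case False
    then have "coeff q k = 0" using q(2) by (intro coeff_eq_0) auto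
    then have "coeff p k = c" by (simp add: p_def)
    then show ?thesis using c q(2)
      by (auto simp: p_def intro!: degree_diff_le degree_monom_le)
  qed
  then have "card {y. poly p y = 0} \<le> k" "finite {y. poly p y = 0}"
    using card_poly_roots_bound[of p] poly_roots_finite[of p] by auto
  moreover have "set xs \<subseteq> {y. poly p y = 0}"
  proof
    fix y assume "y \<in> set xs"
    then have "ext_prod (Suc k) (y # xs) (True # top) = 0"
      by (rule ext_prod_Cons_member) (simp add: top_def)
    then show "y \<in> {y. poly p y = 0}" by (simp only: p mem_Collect_eq)
  qed
  moreover have "card (set xs) = k" using Cons.prems by (simp add: k_def distinct_card)
  \<comment> \<open>The \<open>k\<close> points of \<open>xs\<close> exhaust the possible roots, so
    the new point \<open>x\<close> is not a root.\<close>
  ultimately have "set xs = {y. poly p y = 0}" by (intro card_seteq) auto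
  then have "poly p x \<noteq> 0" using Cons.prems by auto
  then show ?case using p[of x] by (simp add: k_def top_def del: ext_prod.simps)
qed simp

lemma count_list_replicate: "count_list (replicate n x) x = n"
  by (induction n) simp_all

lemma ext_prod_top:
  assumes "ext_prod k xs (replicate k True) \<noteq> 0"
  shows "distinct xs \<and> k \<le> length xs"
  using assms ext_prod_not_distinct[of xs "replicate k True" k] ext_prod_degree[of "replicate k True" k xs]
  by (auto simp: count_list_replicate not_less[symmetric])

section \<open>Detecting unions of prescribed size\<close>

text \<open>The tensor square is encoded by bit lists of length \<open>2 * k\<close>, one half for each factor. Padding the
  vector with zeros makes the outer product act on the first half only, without sign changes.\<close>

definition ext_op :: "nat \<Rightarrow> int \<Rightarrow> (bool list \<Rightarrow> int) \<Rightarrow> bool list \<Rightarrow> int" where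
  "ext_op k x F = wedge (dpowers k x @ replicate k 0)
     (\<lambda>b. wedge (dpowers k x) (\<lambda>r. F (take k b @ r)) (drop k b))"

text \<open>Elements of the universe are represented by their positions, starting from
  \<open>x\<close>. Each set bit applies the operator \<open>1 + ext_op k x\<close>; expanding the
  product gives one term per subset of the row, and \<open>rows_step\<close> sums over the choice of
  a row.\<close>

fun row_step :: "nat \<Rightarrow> bool list \<Rightarrow> int \<Rightarrow> (bool list \<Rightarrow> int) \<Rightarrow> bool list \<Rightarrow> int" where
  "row_step k [] x F = F"
| "row_step k (a # as) x F = row_step k as (x + 1) (if a then \<lambda>b. F b + ext_op k x F b else F)"

fun rows_step :: "nat \<Rightarrow> bool list list \<Rightarrow> (bool list \<Rightarrow> int) \<Rightarrow> bool list \<Rightarrow> int" where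
  "rows_step k [] F = (\<lambda>b. 0)"
| "rows_step k (r # rs) F = (\<lambda>b. row_step k r 0 F b + rows_step k rs F b)"

definition ext_unit :: "bool list \<Rightarrow> int" where
  "ext_unit b = of_bool (True \<notin> set b)"

text \<open>Says that \<open>F\<close> is the sum of the tensors \<open>w \<otimes> w\<close> with
  \<open>w = ext_prod k xs\<close>, over \<open>xs\<close> in \<open>X\<close> with multiplicity.
  The list \<open>X\<close> is used for the proof only and is never computed by the program.\<close>

definition square_sum :: "nat \<Rightarrow> int list list \<Rightarrow> (bool list \<Rightarrow> int) \<Rightarrow> bool" where
  "square_sum k X F \<longleftrightarrow>
     (\<forall>b. length b = 2 * k \<longrightarrow> F b = (\<Sum>xs\<leftarrow>X. ext_prod k xs (take k b) * ext_prod k xs (drop k b)))"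

lemma square_sum_unit: "square_sum k [[]] ext_unit"
  unfolding square_sum_def
proof (intro allI impI)
  fix b :: "bool list"
  have "set b = set (take k b) \<union> set (drop k b)"
    by (metis append_take_drop_id set_append)
  then show "ext_unit b = (\<Sum>xs\<leftarrow>[[]]. ext_prod k xs (take k b) * ext_prod k xs (drop k b))"
    by (simp add: ext_unit_def)
qed

lemma square_sum_append:
  "square_sum k X F \<Longrightarrow> square_sum k Y G \<Longrightarrow> square_sum k (X @ Y) (\<lambda>b. F b + G b)"
  by (simp add: square_sum_def)

text \<open>Wedging both tensor factors with the same vector \<open>v\<close> turns
  \<open>w \<otimes> w\<close> into \<open>(v \<and> w) \<otimes> (v \<and> w)\<close>, so the shape
  of a sum of squares is preserved.\<close>

lemma square_sum_ext_op:
  assumes "square_sum k X F"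
  shows "square_sum k (map ((#) x) X) (ext_op k x F)"
  unfolding square_sum_def
proof (intro allI impI)
  fix b :: "bool list" assume b: "length b = 2 * k"
  \<comment> \<open>The second tensor factor comes first, with the first half of the bits frozen to
    \<open>a\<close>.\<close>
  have inner: "wedge (dpowers k x) (\<lambda>r. F (a @ r)) (drop k b) =
      (\<Sum>xs\<leftarrow>X. ext_prod k xs a * ext_prod k (x # xs) (drop k b))"
    if a: "length a = k" for a
  proof -
    have "wedge (dpowers k x) (\<lambda>r. F (a @ r)) (drop k b) =
        wedge (dpowers k x) (\<lambda>r. \<Sum>xs\<leftarrow>X. ext_prod k xs a * ext_prod k xs r) (drop k b)"
      by (rule wedge_cong) (use a b assms in \<open>simp_all add: square_sum_def\<close>)
    then show ?thesis by (simp add: wedge_sum_list wedge_cmult)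
  qed
  have "ext_op k x F b =
      wedge (dpowers k x) (\<lambda>a. wedge (dpowers k x) (\<lambda>r. F (a @ r)) (drop k b)) (take k b)"
    unfolding ext_op_def
    by (subst wedge_append_zeros) (use b in \<open>auto intro!: wedge_cong\<close>)
  also have "\<dots> = wedge (dpowers k x)
      (\<lambda>a. \<Sum>xs\<leftarrow>X. ext_prod k xs a * ext_prod k (x # xs) (drop k b)) (take k b)"
    by (rule wedge_cong) (use b inner in simp_all)
  finally show "ext_op k x F b =
      (\<Sum>xs\<leftarrow>map ((#) x) X. ext_prod k xs (take k b) * ext_prod k xs (drop k b))"
    by (simp add: wedge_sum_list wedge_mult_right o_def)
qed

text \<open>The index lists of the expansion of \<open>row_step\<close>: appending
  \<open>map ((#) x) X\<close> mirrors the addition of \<open>ext_op k x F\<close>.\<close>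

fun row_seqs :: "bool list \<Rightarrow> int \<Rightarrow> int list list \<Rightarrow> int list list" where
  "row_seqs [] x X = X"
| "row_seqs (a # as) x X = row_seqs as (x + 1) (if a then X @ map ((#) x) X else X)"

definition rows_seqs :: "bool list list \<Rightarrow> int list list \<Rightarrow> int list list" where
  "rows_seqs rows X = concat (map (\<lambda>r. row_seqs r 0 X) rows)"

lemma set_rows_seqs: "set (rows_seqs rows X) = (\<Union>r\<in>set rows. set (row_seqs r 0 X))"
  by (simp add: rows_seqs_def)

fun row_elems :: "bool list \<Rightarrow> int \<Rightarrow> int set" where
  "row_elems [] x = {}"
| "row_elems (a # as) x = (if a then {x} else {}) \<union> row_elems as (x + 1)"

lemma square_sum_row_step: "square_sum k X F \<Longrightarrow> square_sum k (row_seqs r x X) (row_step k r x F)"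
  by (induction r arbitrary: x X F) (simp_all add: square_sum_append square_sum_ext_op)

lemma square_sum_rows_step:
  "square_sum k X F \<Longrightarrow> square_sum k (rows_seqs rows X) (rows_step k rows F)"
proof (induction rows)
  case Nil
  then show ?case by (simp add: rows_seqs_def square_sum_def)
next
  case (Cons r rows)
  then show ?case by (simp add: rows_seqs_def square_sum_append square_sum_row_step)
qed

lemma square_sum_iterate:
  "square_sum k ((rows_seqs rows ^^ m) [[]]) ((rows_step k rows ^^ m) ext_unit)"
  by (induction m) (simp_all add: square_sum_unit square_sum_rows_step)

lemma finite_row_elems [simp]: "finite (row_elems r x)"
  by (induction r arbitrary: x) auto

lemma row_elems_ge: "y \<in> row_elems r x \<Longrightarrow> x \<le> y"
proof (induction r arbitrary: x)
  case (Cons a r)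
  then have "y = x \<or> y \<in> row_elems r (x + 1)" by (simp split: if_splits)
  with Cons.IH[of "x + 1"] show ?case by linarith
qed simp

text \<open>Inclusion is enough here: lists with repetitions do arise across rows, but their
  products vanish by \<open>ext_prod_not_distinct\<close>.\<close>

lemma row_seqs_sound:
  "zs \<in> set (row_seqs r x X) \<Longrightarrow> \<exists>ys\<in>set X. set zs \<subseteq> row_elems r x \<union> set ys"
proof (induction r arbitrary: x X)
  case (Cons a r)
  from Cons.prems have "zs \<in> set (row_seqs r (x + 1) (if a then X @ map ((#) x) X else X))" by simp
  from Cons.IH[OF this] obtain ys where
    ys: "ys \<in> set (if a then X @ map ((#) x) X else X)" "set zs \<subseteq> row_elems r (x + 1) \<union> set ys" by blast
  then consider "ys \<in> set X" | ys' where "a" "ys' \<in> set X" "ys = x # ys'"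
    by (cases a) auto
  then show ?case
  proof cases
    case 1
    then show ?thesis using ys(2) by (intro bexI[of _ ys]) auto
  next
    case 2
    then show ?thesis using ys(2) by (intro bexI[of _ ys']) auto
  qed
qed auto

text \<open>The wanted list prepends exactly the positions in \<open>C\<close>; it stays distinct
  because \<open>C\<close> avoids \<open>ys\<close> and positions increase along the row.\<close>

lemma row_seqs_complete:
  "ys \<in> set X \<Longrightarrow> distinct ys \<Longrightarrow> C \<subseteq> row_elems r x \<Longrightarrow> C \<inter> set ys = {} \<Longrightarrow>
   \<exists>zs\<in>set (row_seqs r x X). distinct zs \<and> set zs = C \<union> set ys"
proof (induction r arbitrary: x X C ys)
  case (Cons a r)
  show ?case
  proof (cases "x \<in> C")
    case True
    \<comment> \<open>Later positions are larger, so \<open>x\<close> can belong to the row only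
      through the current bit.\<close>
    have "x \<notin> row_elems r (x + 1)" using row_elems_ge[of x r "x + 1"] by auto
    then have "a" using True Cons.prems(3) by (auto split: if_splits)
    have "\<exists>zs\<in>set (row_seqs r (x + 1) (X @ map ((#) x) X)). distinct zs \<and> set zs = (C - {x}) \<union> set (x # ys)"
      by (rule Cons.IH) (use Cons.prems True in \<open>auto split: if_splits\<close>)
    with \<open>a\<close> True show ?thesis by auto
  next
    case False
    have "\<exists>zs\<in>set (row_seqs r (x + 1) (if a then X @ map ((#) x) X else X)). distinct zs \<and> set zs = C \<union> set ys"
      by (rule Cons.IH) (use Cons.prems False in \<open>auto split: if_splits\<close>)
    then show ?thesis by auto
  qed
qed auto

definition union_test :: "bool list list \<Rightarrow> nat \<Rightarrow> nat \<Rightarrow> bool" where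
  "union_test rows m k \<longleftrightarrow>
     (\<exists>rs. length rs = m \<and> set rs \<subseteq> set rows \<and> k \<le> card (\<Union>r\<in>set rs. row_elems r 0))"

lemma rows_seqs_iterate_sound:
  "zs \<in> set ((rows_seqs rows ^^ m) [[]]) \<Longrightarrow>
   \<exists>rs. length rs = m \<and> set rs \<subseteq> set rows \<and> set zs \<subseteq> (\<Union>r\<in>set rs. row_elems r 0)"
proof (induction m arbitrary: zs)
  case (Suc m)
  then obtain r where r: "r \<in> set rows" "zs \<in> set (row_seqs r 0 ((rows_seqs rows ^^ m) [[]]))"
    by (auto simp: set_rows_seqs)
  from row_seqs_sound[OF r(2)] obtain ys where
    ys: "ys \<in> set ((rows_seqs rows ^^ m) [[]])" "set zs \<subseteq> row_elems r 0 \<union> set ys" by blast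
  from Suc.IH[OF ys(1)] obtain rs where
    "length rs = m" "set rs \<subseteq> set rows" "set ys \<subseteq> (\<Union>r\<in>set rs. row_elems r 0)" by blast
  with r ys show ?case by (intro exI[of _ "r # rs"]) auto
qed simp

lemma rows_seqs_iterate_complete:
  "set rs \<subseteq> set rows \<Longrightarrow> C \<subseteq> (\<Union>r\<in>set rs. row_elems r 0) \<Longrightarrow>
   \<exists>zs\<in>set ((rows_seqs rows ^^ length rs) [[]]). distinct zs \<and> set zs = C"
proof (induction rs arbitrary: C)
  case (Cons r rs)
  \<comment> \<open>The row \<open>r\<close> accounts for all elements of \<open>C\<close> that it
    contains, so the other rows only have to produce the rest. Thus no element is picked
    twice.\<close>
  obtain ys where ys: "ys \<in> set ((rows_seqs rows ^^ length rs) [[]])" "distinct ys" "set ys = C - row_elems r 0"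
    using Cons.IH[of "C - row_elems r 0"] Cons.prems by auto
  then obtain zs where "zs \<in> set (row_seqs r 0 ((rows_seqs rows ^^ length rs) [[]]))" "distinct zs"
      "set zs = (C \<inter> row_elems r 0) \<union> set ys"
    using row_seqs_complete[OF ys(1,2), of "C \<inter> row_elems r 0" r 0] by auto
  with ys(3) Cons.prems(1) show ?case by (intro bexI[of _ zs]) (auto simp: set_rows_seqs)
qed auto

text \<open>The top coefficient is a sum of squares over all choices of \<open>m\<close> rows and of
  elements from them. It is positive iff one of the products has a nonzero top coefficient, which
  requires at least \<open>k\<close> distinct elements and is ensured by exactly
  \<open>k\<close>.\<close>

theorem top_coefficient_pos_iff:
  "0 < (rows_step k rows ^^ m) ext_unit (replicate (2 * k) True) \<longleftrightarrow> union_test rows m k"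
proof -
  define X where "X = (rows_seqs rows ^^ m) [[]]"
  define g where "g = (\<lambda>xs. (ext_prod k xs (replicate k True))\<^sup>2)"
  have top: "(rows_step k rows ^^ m) ext_unit (replicate (2 * k) True) = (\<Sum>xs\<leftarrow>X. g xs)"
    using square_sum_iterate[where k = k and rows = rows and m = m]
    by (simp add: square_sum_def X_def g_def power2_eq_square)
  have "0 < (\<Sum>xs\<leftarrow>X. g xs) \<longleftrightarrow> (\<exists>xs\<in>set X. ext_prod k xs (replicate k True) \<noteq> 0)"
  proof -
    have nonneg: "0 \<le> (\<Sum>xs\<leftarrow>X. g xs)"
      by (rule sum_list_nonneg) (auto simp: g_def)
    have "(\<Sum>xs\<leftarrow>X. g xs) = 0 \<longleftrightarrow> (\<forall>y\<in>set (map g X). y = 0)"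
      by (rule sum_list_nonneg_eq_0_iff) (auto simp: g_def)
    also have "\<dots> \<longleftrightarrow> (\<forall>xs\<in>set X. ext_prod k xs (replicate k True) = 0)" by (simp add: g_def)
    finally show ?thesis using nonneg by (metis less_le)
  qed
  also have "\<dots> \<longleftrightarrow> union_test rows m k"
  proof
    assume "\<exists>xs\<in>set X. ext_prod k xs (replicate k True) \<noteq> 0"
    then obtain xs where xs: "xs \<in> set X" "ext_prod k xs (replicate k True) \<noteq> 0" by blast
    obtain rs where rs: "length rs = m" "set rs \<subseteq> set rows" "set xs \<subseteq> (\<Union>r\<in>set rs. row_elems r 0)"
      using rows_seqs_iterate_sound[OF xs(1)[unfolded X_def]] by blast
    have "k \<le> card (set xs)" using ext_prod_top[OF xs(2)] by (simp add: distinct_card)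
    also have "\<dots> \<le> card (\<Union>r\<in>set rs. row_elems r 0)" by (intro card_mono rs(3)) auto
    finally show "union_test rows m k" using rs by (auto simp: union_test_def)
  next
    assume "union_test rows m k"
    then obtain rs where rs: "length rs = m" "set rs \<subseteq> set rows" "k \<le> card (\<Union>r\<in>set rs. row_elems r 0)"
      by (auto simp: union_test_def)
    \<comment> \<open>A larger union is cut down to exactly \<open>k\<close> elements, since
      nonvanishing is known only when there are as many points as coordinates.\<close>
    obtain C where C: "C \<subseteq> (\<Union>r\<in>set rs. row_elems r 0)" "card C = k"
      using obtain_subset_with_card_n[OF rs(3)] by metis
    obtain zs where zs: "zs \<in> set X" "distinct zs" "set zs = C"
      using rows_seqs_iterate_complete[OF rs(2) C(1)] rs(1) by (auto simp: X_def)
    then have "length zs = k" using C distinct_card by fastforce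
    with zs ext_prod_top_nonzero[OF zs(2)] show "\<exists>xs\<in>set X. ext_prod k xs (replicate k True) \<noteq> 0" by auto
  qed
  finally show ?thesis by (simp only: top)
qed

section \<open>Cost calculus and the program\<close>

definition fits :: "nat \<Rightarrow> int \<Rightarrow> bool" where
  "fits B a \<longleftrightarrow> \<bar>a\<bar> < 2 ^ B"

lemma fits_mono: "fits B a \<Longrightarrow> \<bar>b\<bar> \<le> \<bar>a\<bar> \<Longrightarrow> fits B b"
  by (simp add: fits_def)

lemma fits_0 [simp]: "fits B 0"
  by (simp add: fits_def)

lemma bits_le: "fits B a \<Longrightarrow> bits a \<le> B"
  unfolding fits_def bits_def by (rule floorlog_leI) (simp_all add: nat_less_iff)

definition unit_cost :: "nat \<Rightarrow> nat" where
  "unit_cost B = (B + 1)\<^sup>2"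

lemma unit_pos: "1 \<le> unit_cost B"
  by (simp add: unit_cost_def)

lemma unit_linear: "1 + B + B \<le> unit_cost B"
  by (simp add: unit_cost_def power2_eq_square)

text \<open>Time is counted in units that pay for any single arithmetic operation on integers of at most
  \<open>B\<close> bits; all integers that occur must then be shown to fit.\<close>

definition ev :: "program \<Rightarrow> nat \<Rightarrow> val list \<Rightarrow> expr \<Rightarrow> val \<Rightarrow> nat \<Rightarrow> bool" where
  "ev P B env e v u \<longleftrightarrow> (\<exists>c\<le>u * unit_cost B. eval P env e v c)"

definition evs :: "program \<Rightarrow> nat \<Rightarrow> val list \<Rightarrow> expr list \<Rightarrow> val list \<Rightarrow> nat \<Rightarrow> bool" where
  "evs P B env es vs u \<longleftrightarrow> (\<exists>c\<le>u * unit_cost B. evals P env es vs c)"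

definition fn :: "program \<Rightarrow> nat \<Rightarrow> nat \<Rightarrow> val list \<Rightarrow> val \<Rightarrow> nat \<Rightarrow> bool" where
  "fn P B f vs v u \<longleftrightarrow> f < length P \<and> ev P B vs (P ! f) v u"

text \<open>With this intermediate judgement one rule covers both branches of \<open>ECase\<close>:
  the branch is selected only after the value \<open>w\<close> of the scrutinee is known.\<close>

definition ev_case :: "program \<Rightarrow> nat \<Rightarrow> val list \<Rightarrow> val \<Rightarrow> expr \<Rightarrow> expr \<Rightarrow> val \<Rightarrow> nat \<Rightarrow> bool" where
  "ev_case P B env w e1 e2 v u \<longleftrightarrow>
     (case w of VNil \<Rightarrow> ev P B env e1 v u | VCons x y \<Rightarrow> ev P B (x # y # env) e2 v u | VInt _ \<Rightarrow> False)"

lemma ev_eq: "ev P B env e v u \<Longrightarrow> v = v' \<Longrightarrow> u \<le> u' \<Longrightarrow> ev P B env e v' u'"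
  unfolding ev_def by (meson mult_le_mono1 order_trans)

lemma fn_eq: "fn P B f vs v u \<Longrightarrow> v = v' \<Longrightarrow> u \<le> u' \<Longrightarrow> fn P B f vs v' u'"
  unfolding fn_def using ev_eq by blast

lemma fnI: "P ! f = e \<Longrightarrow> f < length P \<Longrightarrow> ev P B vs e v u \<Longrightarrow> v = v' \<Longrightarrow> u \<le> u' \<Longrightarrow> fn P B f vs v' u'"
  unfolding fn_def using ev_eq by blast

lemma ev_Var: "i < length env \<Longrightarrow> env ! i = v \<Longrightarrow> ev P B env (EVar i) v 1"
  unfolding ev_def using eval_evals.Var[of i env P] unit_pos[of B] by auto

lemma ev_Int: "ev P B env (EInt a) (VInt a) 1"
  unfolding ev_def using eval_evals.Int[of P env a] unit_pos[of B] by auto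

lemma ev_Nil: "ev P B env ENil VNil 1"
  unfolding ev_def using eval_evals.Nil[of P env] unit_pos[of B] by auto

lemma ev_Add:
  assumes "ev P B env e1 (VInt a) u1" "ev P B env e2 (VInt b) u2" "fits B a" "fits B b"
  shows "ev P B env (EAdd e1 e2) (VInt (a + b)) (u1 + u2 + 1)"
proof -
  obtain c1 c2 where c: "eval P env e1 (VInt a) c1" "c1 \<le> u1 * unit_cost B"
    "eval P env e2 (VInt b) c2" "c2 \<le> u2 * unit_cost B" using assms by (auto simp: ev_def)
  show ?thesis unfolding ev_def
    using eval_evals.Add[OF c(1,3)] c(2,4) bits_le[OF assms(3)] bits_le[OF assms(4)] unit_linear[of B]
    by (intro exI[of _ "c1 + c2 + 1 + bits a + bits b"]) (simp add: add_mult_distrib)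
qed

lemma ev_Sub:
  assumes "ev P B env e1 (VInt a) u1" "ev P B env e2 (VInt b) u2" "fits B a" "fits B b"
  shows "ev P B env (ESub e1 e2) (VInt (a - b)) (u1 + u2 + 1)"
proof -
  obtain c1 c2 where c: "eval P env e1 (VInt a) c1" "c1 \<le> u1 * unit_cost B"
    "eval P env e2 (VInt b) c2" "c2 \<le> u2 * unit_cost B" using assms by (auto simp: ev_def)
  show ?thesis unfolding ev_def
    using eval_evals.Sub[OF c(1,3)] c(2,4) bits_le[OF assms(3)] bits_le[OF assms(4)] unit_linear[of B]
    by (intro exI[of _ "c1 + c2 + 1 + bits a + bits b"]) (simp add: add_mult_distrib)
qed

lemma ev_Mul:
  assumes "ev P B env e1 (VInt a) u1" "ev P B env e2 (VInt b) u2" "fits B a" "fits B b"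
  shows "ev P B env (EMul e1 e2) (VInt (a * b)) (u1 + u2 + 1)"
proof -
  obtain c1 c2 where c: "eval P env e1 (VInt a) c1" "c1 \<le> u1 * unit_cost B"
    "eval P env e2 (VInt b) c2" "c2 \<le> u2 * unit_cost B" using assms by (auto simp: ev_def)
  have "(1 + bits a) * (1 + bits b) \<le> unit_cost B"
    unfolding unit_cost_def power2_eq_square using bits_le[OF assms(3)] bits_le[OF assms(4)] by (intro mult_le_mono) auto
  then show ?thesis unfolding ev_def
    using eval_evals.Mul[OF c(1,3)] c(2,4)
    by (intro exI[of _ "c1 + c2 + (1 + bits a) * (1 + bits b)"]) (simp add: add_mult_distrib)
qed

lemma ev_If_True:
  assumes "ev P B env e1 (VInt a) u1" "ev P B env e2 (VInt b) u2" "fits B a" "fits B b" "a \<le> b"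
    and "ev P B env e3 v u3"
  shows "ev P B env (EIfLe e1 e2 e3 e4) v (u1 + u2 + 1 + u3)"
proof -
  obtain c1 c2 c3 where c: "eval P env e1 (VInt a) c1" "c1 \<le> u1 * unit_cost B"
    "eval P env e2 (VInt b) c2" "c2 \<le> u2 * unit_cost B" "eval P env e3 v c3" "c3 \<le> u3 * unit_cost B"
    using assms by (auto simp: ev_def)
  show ?thesis unfolding ev_def
    using eval_evals.IfLe_True[OF c(1,3) assms(5) c(5), of e4] c(2,4,6) bits_le[OF assms(3)] bits_le[OF assms(4)]
      unit_linear[of B]
    by (intro exI[of _ "c1 + c2 + 1 + bits a + bits b + c3"]) (simp add: add_mult_distrib)
qed

lemma ev_If_False:
  assumes "ev P B env e1 (VInt a) u1" "ev P B env e2 (VInt b) u2" "fits B a" "fits B b" "\<not> a \<le> b"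
    and "ev P B env e4 v u3"
  shows "ev P B env (EIfLe e1 e2 e3 e4) v (u1 + u2 + 1 + u3)"
proof -
  obtain c1 c2 c3 where c: "eval P env e1 (VInt a) c1" "c1 \<le> u1 * unit_cost B"
    "eval P env e2 (VInt b) c2" "c2 \<le> u2 * unit_cost B" "eval P env e4 v c3" "c3 \<le> u3 * unit_cost B"
    using assms by (auto simp: ev_def)
  show ?thesis unfolding ev_def
    using eval_evals.IfLe_False[OF c(1,3) assms(5) c(5), of e3] c(2,4,6) bits_le[OF assms(3)] bits_le[OF assms(4)]
      unit_linear[of B]
    by (intro exI[of _ "c1 + c2 + 1 + bits a + bits b + c3"]) (simp add: add_mult_distrib)
qed

lemma ev_Cons:
  assumes "ev P B env e1 v1 u1" "ev P B env e2 v2 u2"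
  shows "ev P B env (ECons e1 e2) (VCons v1 v2) (u1 + u2 + 1)"
proof -
  obtain c1 c2 where c: "eval P env e1 v1 c1" "c1 \<le> u1 * unit_cost B"
    "eval P env e2 v2 c2" "c2 \<le> u2 * unit_cost B" using assms by (auto simp: ev_def)
  show ?thesis unfolding ev_def
    using eval_evals.Cons[OF c(1,3)] c(2,4) unit_pos[of B]
    by (intro exI[of _ "c1 + c2 + 1"]) (simp add: add_mult_distrib)
qed

lemma ev_Case:
  assumes "ev P B env e w u1" "ev_case P B env w e1 e2 v u2"
  shows "ev P B env (ECase e e1 e2) v (u1 + 1 + u2)"
proof -
  obtain c1 where c1: "eval P env e w c1" "c1 \<le> u1 * unit_cost B" using assms by (auto simp: ev_def)
  obtain c2 where "eval P env (ECase e e1 e2) v (c1 + 1 + c2)" "c2 \<le> u2 * unit_cost B"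
  proof (cases w)
    case VNil
    then obtain c2 where "eval P env e1 v c2" "c2 \<le> u2 * unit_cost B"
      using assms(2) by (auto simp: ev_case_def ev_def)
    then show ?thesis using that Case_Nil c1(1) VNil by blast
  next
    case (VCons x y)
    then obtain c2 where "eval P (x # y # env) e2 v c2" "c2 \<le> u2 * unit_cost B"
      using assms(2) by (auto simp: ev_case_def ev_def)
    then show ?thesis using that Case_Cons c1(1) VCons by blast
  qed (use assms(2) in \<open>simp add: ev_case_def\<close>)
  then show ?thesis unfolding ev_def using c1(2) unit_pos[of B]
    by (intro exI[of _ "c1 + 1 + c2"]) (simp add: add_mult_distrib)
qed

lemma ev_case_VNil: "ev P B env e1 v u \<Longrightarrow> ev_case P B env VNil e1 e2 v u"
  by (simp add: ev_case_def)

lemma ev_case_VCons: "ev P B (x # y # env) e2 v u \<Longrightarrow> ev_case P B env (VCons x y) e1 e2 v u"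
  by (simp add: ev_case_def)

lemma ev_Let:
  assumes "ev P B env e1 v1 u1" "ev P B (v1 # env) e2 v u2"
  shows "ev P B env (ELet e1 e2) v (u1 + 1 + u2)"
proof -
  obtain c1 c2 where c: "eval P env e1 v1 c1" "c1 \<le> u1 * unit_cost B"
    "eval P (v1 # env) e2 v c2" "c2 \<le> u2 * unit_cost B" using assms by (auto simp: ev_def)
  show ?thesis unfolding ev_def
    using eval_evals.Let[OF c(1,3)] c(2,4) unit_pos[of B]
    by (intro exI[of _ "c1 + 1 + c2"]) (simp add: add_mult_distrib)
qed

lemma ev_Call:
  assumes "evs P B env es vs u1" "fn P B f vs v u2"
  shows "ev P B env (ECall f es) v (u1 + 1 + u2)"
proof -
  obtain c1 c2 where c: "evals P env es vs c1" "c1 \<le> u1 * unit_cost B" "f < length P"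
    "eval P vs (P ! f) v c2" "c2 \<le> u2 * unit_cost B" using assms by (auto simp: ev_def evs_def fn_def)
  show ?thesis unfolding ev_def
    using eval_evals.Call[OF c(1,3,4)] c(2,5) unit_pos[of B]
    by (intro exI[of _ "c1 + 1 + c2"]) (simp add: add_mult_distrib)
qed

lemma evs_Nil: "evs P B env [] [] 0"
  unfolding evs_def using eval_evals.Args_Nil by blast

lemma evs_Cons:
  assumes "ev P B env e v u1" "evs P B env es vs u2"
  shows "evs P B env (e # es) (v # vs) (u1 + u2)"
proof -
  obtain c1 c2 where c: "eval P env e v c1" "c1 \<le> u1 * unit_cost B"
    "evals P env es vs c2" "c2 \<le> u2 * unit_cost B" using assms by (auto simp: ev_def evs_def)
  show ?thesis unfolding evs_def
    using eval_evals.Args_Cons[OF c(1,3)] c(2,4)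
    by (intro exI[of _ "c1 + c2"]) (simp add: add_mult_distrib)
qed

lemmas ev_straight = ev_Var ev_Int ev_Nil ev_Add ev_Sub ev_Mul ev_Cons ev_Case ev_case_VNil
  ev_case_VCons ev_Call evs_Nil evs_Cons

lemmas ev_intros = ev_straight ev_Let

section \<open>The program\<close>

text \<open>Elements of the exterior algebra are stored as complete binary trees. These carry no depth
  information, so each function takes a list of that length along; its entries matter only for
  vectors and for the lists of zeros that are used as padding.\<close>

definition lincomb_body :: expr where
  "lincomb_body = ECase (EVar 0)
     (EAdd (EMul (EVar 1) (EVar 2)) (EMul (EVar 3) (EVar 4)))
     (ECase (EVar 4) ENil (ECase (EVar 8) ENil
       (ECons (ECall 1 [EVar 5, EVar 7, EVar 2, EVar 9, EVar 0])
              (ECall 1 [EVar 5, EVar 7, EVar 3, EVar 9, EVar 1]))))"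

definition wedge_body :: expr where
  "wedge_body = ECase (EVar 0) (EInt 0)
     (ECase (EVar 3) ENil
       (ECons (ECall 2 [EVar 3, EVar 0])
              (ECall 1 [EVar 3, EVar 2, EVar 0, EInt (- 1), ECall 2 [EVar 3, EVar 1]])))"

definition inner_body :: expr where
  "inner_body = ECase (EVar 0) (ECall 2 [EVar 1, EVar 2])
     (ECase (EVar 4) ENil
       (ECons (ECall 3 [EVar 3, EVar 5, EVar 0]) (ECall 3 [EVar 3, EVar 5, EVar 1])))"

text \<open>The arguments are a length list, the current power, the base and an accumulator. Powers
  are consed in increasing order, hence come out highest first; starting from a list of zeros yields
  the padded vector.\<close>

definition dpowers_body :: expr where
  "dpowers_body = ECase (EVar 0) (EVar 3)
     (ECall 4 [EVar 1, EMul (EVar 3) (EVar 4), EVar 4, ECons (EVar 3) (EVar 5)])"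

text \<open>The lists of zeros of lengths \<open>k\<close> and \<open>2 * k\<close> are passed as
  the first two arguments; they provide the depths, and the shorter one also the padding.\<close>

definition row_body :: expr where
  "row_body = ECase (EVar 2) (EVar 4)
     (ECall 5 [EVar 2, EVar 3, EVar 1, EAdd (EVar 5) (EInt 1),
        EIfLe (EVar 0) (EInt 0) (EVar 6)
          (ECall 1 [EVar 3, EInt 1, EVar 6, EInt 1,
             ECall 2 [ECall 4 [EVar 2, EInt 1, EVar 5, EVar 2],
                      ECall 3 [EVar 2, ECall 4 [EVar 2, EInt 1, EVar 5, ENil], EVar 6]]])])"

definition rows_body :: expr where
  "rows_body = ECase (EVar 2) (ECall 8 [EVar 1])
     (ECall 1 [EVar 3, EInt 1, ECall 5 [EVar 2, EVar 3, EVar 0, EInt 0, EVar 5], EInt 1,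
        ECall 6 [EVar 2, EVar 3, EVar 1, EVar 5]])"

definition iterate_body :: expr where
  "iterate_body = EIfLe (EVar 0) (EInt 0) (EVar 4)
     (ECall 7 [ESub (EVar 0) (EInt 1), EVar 1, EVar 2, EVar 3,
        ECall 6 [EVar 1, EVar 2, EVar 3, EVar 4]])"

text \<open>Both halves share one subtree, so a tree of exponential size is built in linearly many
  steps.\<close>

definition zero_body :: expr where
  "zero_body = ECase (EVar 0) (EInt 0) (ELet (ECall 8 [EVar 1]) (ECons (EVar 0) (EVar 0)))"

definition unit_body :: expr where
  "unit_body = ECase (EVar 0) (EInt 1) (ECons (ECall 9 [EVar 1]) (ECall 8 [EVar 1]))"

definition top_body :: expr where
  "top_body = ECase (EVar 0) (EVar 1) (ECase (EVar 3) ENil (ECall 10 [EVar 3, EVar 1]))"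

definition zeros_body :: expr where
  "zeros_body = EIfLe (EVar 0) (EInt 0) ENil (ECons (EInt 0) (ECall 11 [ESub (EVar 0) (EInt 1)]))"

definition power_body :: expr where
  "power_body = EIfLe (EVar 1) (EInt 0) (EInt 1)
     (EMul (EVar 0) (ECall 12 [EVar 0, ESub (EVar 1) (EInt 1)]))"

text \<open>Decides whether a list has more than a given number \<open>L\<close> of entries by
  looking at no more than \<open>L + 1\<close> of its cells, so that an input of excessive length is
  never read to its end.\<close>

definition longer_body :: expr where
  "longer_body = ECase (EVar 1) (EInt 0)
     (EIfLe (EVar 2) (EInt 0) (EInt 1) (ECall 13 [ESub (EVar 2) (EInt 1), EVar 1]))"

text \<open>The language has no division; repeated subtraction of \<open>t\<close> is affordable
  because \<open>n\<close> steps are.\<close>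

definition neg_mod_body :: "nat \<Rightarrow> expr" where
  "neg_mod_body t = EIfLe (EVar 0) (EInt 0) (ESub (EInt 0) (EVar 0))
     (ECall 14 [ESub (EVar 0) (EInt (int t))])"

definition test_body :: expr where
  "test_body = ELet (ECall 11 [EVar 1]) (ELet (ECall 11 [EAdd (EVar 2) (EVar 2)])
     (EIfLe (ECall 10 [EVar 0, ECall 7 [EVar 2, EVar 1, EVar 0, EVar 4, ECall 9 [EVar 0]]]) (EInt 0)
       (EInt 0) (EInt 1)))"

definition search_body :: "nat \<Rightarrow> expr" where
  "search_body t = EIfLe (EVar 0) (EVar 1)
     (EIfLe (ECall 15 [EVar 0, EAdd (EMul (EInt (int t)) (EVar 0)) (EVar 1), EVar 2]) (EInt 0)
       (ECall 16 [EAdd (EVar 0) (EInt 1), EVar 1, EVar 2]) (EInt 1))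
     (EInt 0)"

text \<open>For \<open>k \<le> 0\<close> only \<open>0 < n < t\<close> needs a computation: then
  \<open>\<lceil>n/t\<rceil> = 1\<close>, and \<open>1 - k\<close> sets have to cover all
  \<open>n\<close> elements. For \<open>k \<ge> 1\<close>, a family exceeding the bound of
  \<open>card_family_bound\<close> guarantees a cover, and the search is started only below that
  bound.\<close>

definition main_body :: "nat \<Rightarrow> expr" where
  "main_body t = ECase (EVar 0) ENil (ECase (EVar 1) ENil (ECase (EVar 1) ENil
     (EIfLe (EVar 4) (EInt 0)
       (EIfLe (EInt (int t)) (EVar 2) (EInt 1)
         (EIfLe (EVar 2) (EInt 0) (EInt 1)
           (ECall 15 [ESub (EInt 1) (EVar 4), EVar 2, EVar 0])))
       (ELet (ESub (EMul (EInt (int t)) (EVar 4)) (ECall 14 [EVar 2]))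
         (EIfLe
           (ECall 13 [EMul (ECall 12 [EInt 2, EMul (EInt (int t + 1)) (EVar 0)])
                           (ECall 12 [EAdd (EVar 3) (EInt 1), EInt (int t)]),
                      EVar 1])
           (EInt 0)
           (ECall 16 [EInt 0, EVar 0, EVar 1])
           (EInt 1))))))"

definition set_cover_program :: "nat \<Rightarrow> program" where
  "set_cover_program t = [main_body t, lincomb_body, wedge_body, inner_body, dpowers_body, row_body,
     rows_body, iterate_body, zero_body, unit_body, top_body, zeros_body, power_body, longer_body,
     neg_mod_body t, test_body, search_body t]"

abbreviation run :: "nat \<Rightarrow> nat \<Rightarrow> nat \<Rightarrow> val list \<Rightarrow> val \<Rightarrow> nat \<Rightarrow> bool" where
  "run t \<equiv> fn (set_cover_program t)"

lemma program_nth: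
  "set_cover_program t ! 0 = main_body t"
  "set_cover_program t ! 1 = lincomb_body"
  "set_cover_program t ! 2 = wedge_body"
  "set_cover_program t ! 3 = inner_body"
  "set_cover_program t ! 4 = dpowers_body"
  "set_cover_program t ! 5 = row_body"
  "set_cover_program t ! 6 = rows_body"
  "set_cover_program t ! 7 = iterate_body"
  "set_cover_program t ! 8 = zero_body"
  "set_cover_program t ! 9 = unit_body"
  "set_cover_program t ! 10 = top_body"
  "set_cover_program t ! 11 = zeros_body"
  "set_cover_program t ! 12 = power_body"
  "set_cover_program t ! 13 = longer_body"
  "set_cover_program t ! 14 = neg_mod_body t"
  "set_cover_program t ! 15 = test_body"
  "set_cover_program t ! 16 = search_body t"
  by (simp_all add: set_cover_program_def)

lemma length_program: "length (set_cover_program t) = 17"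
  by (simp add: set_cover_program_def)

section \<open>Correctness and cost of the exterior algebra routines\<close>

fun tensor_val :: "nat \<Rightarrow> (bool list \<Rightarrow> int) \<Rightarrow> val" where
  "tensor_val 0 g = VInt (g [])"
| "tensor_val (Suc d) g = VCons (tensor_val d (\<lambda>r. g (False # r))) (tensor_val d (\<lambda>r. g (True # r)))"

definition bounded_by :: "nat \<Rightarrow> int \<Rightarrow> (bool list \<Rightarrow> int) \<Rightarrow> bool" where
  "bounded_by d M g \<longleftrightarrow> (\<forall>b. length b = d \<longrightarrow> \<bar>g b\<bar> \<le> M)"

lemma bounded_by_Cons: "bounded_by (Suc d) M g \<Longrightarrow> bounded_by d M (\<lambda>r. g (x # r))"
  by (simp add: bounded_by_def)

lemma bounded_by_Nil: "bounded_by 0 M g \<Longrightarrow> \<bar>g []\<bar> \<le> M"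
  by (simp add: bounded_by_def)

text \<open>The constants in this and the following cost functions bound the units that the
  evaluation rules charge for one level of the recursion.\<close>

primrec lincomb_cost :: "nat \<Rightarrow> nat" where
  "lincomb_cost 0 = 9"
| "lincomb_cost (Suc d) = 19 + 2 * lincomb_cost d"

text \<open>Only operands are charged: the products have to fit because they are added, whereas the
  sum itself need not fit.\<close>

lemma run_lincomb:
  assumes "length ds = d" "bounded_by d M A" "bounded_by d N C" "fits B c" "fits B e" "fits B M" "fits B N"
    "fits B (c * M)" "fits B (e * N)"
  shows "run t B 1 [list_val ds, VInt c, tensor_val d A, VInt e, tensor_val d C]
    (tensor_val d (\<lambda>b. c * A b + e * C b)) (lincomb_cost d)"
  using assms(1-3)
proof (induction ds arbitrary: d A C)
  case Nil
  then have A: "\<bar>A []\<bar> \<le> \<bar>M\<bar>" "\<bar>C []\<bar> \<le> \<bar>N\<bar>" using bounded_by_Nil by fastforce+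
  then have f: "fits B (A [])" "fits B (C [])" "fits B (c * A [])" "fits B (e * C [])"
    using assms(6-9) by (auto intro: fits_mono simp: abs_mult mult_left_mono)
  from Nil have d: "d = 0" by simp
  show ?case
    unfolding d
    apply (rule fnI[OF program_nth(2)[unfolded lincomb_body_def]])
       apply (simp add: length_program)
      apply (rule ev_intros f assms(4,5) | simp)+
    done
next
  case (Cons y ds)
  then obtain d' where d: "d = Suc d'" "length ds = d'" by auto
  have IH: "run t B 1 [list_val ds, VInt c, tensor_val d' (\<lambda>r. A (x # r)), VInt e, tensor_val d' (\<lambda>r. C (x # r))]
    (tensor_val d' (\<lambda>b. c * A (x # b) + e * C (x # b))) (lincomb_cost d')" for x
    by (rule Cons.IH) (use d Cons.prems bounded_by_Cons in auto)
  show ?case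
    unfolding d(1)
    apply (rule fnI[OF program_nth(2)[unfolded lincomb_body_def]])
       apply (simp add: length_program)
      apply (rule ev_intros IH | simp)+
    done
qed

primrec wedge_cost :: "nat \<Rightarrow> nat" where
  "wedge_cost 0 = 3"
| "wedge_cost (Suc d) = 16 + 2 * wedge_cost d + lincomb_cost d"

lemma sum_list_abs_nonneg: "0 \<le> (\<Sum>x\<leftarrow>v. \<bar>x\<bar> :: int)"
  by (rule sum_list_nonneg) auto

lemma fits_le: "fits B b \<Longrightarrow> 0 \<le> a \<Longrightarrow> a \<le> b \<Longrightarrow> fits B a"
  by (auto intro: fits_mono)

lemma run_wedge:
  assumes "bounded_by (length v) M g" "1 \<le> M" "fits B ((1 + (\<Sum>x\<leftarrow>v. \<bar>x\<bar>)) * M)"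
  shows "run t B 2 [list_val (map VInt v), tensor_val (length v) g]
    (tensor_val (length v) (wedge v g)) (wedge_cost (length v))"
  using assms(1,3)
proof (induction v arbitrary: g)
  case Nil
  show ?case
    apply (rule fnI[OF program_nth(3)[unfolded wedge_body_def]])
       apply (simp add: length_program)
      apply (rule ev_intros | simp)+
    done
next
  case (Cons c v)
  define s where "s = (\<Sum>x\<leftarrow>v. \<bar>x\<bar>)"
  have s: "0 \<le> s" by (simp add: s_def sum_list_abs_nonneg)
  have F: "fits B ((1 + \<bar>c\<bar> + s) * M)" using Cons.prems(2) by (simp add: s_def add.assoc)
  have le: "\<bar>c\<bar> * M \<le> (1 + \<bar>c\<bar> + s) * M" "(1 + s) * M \<le> (1 + \<bar>c\<bar> + s) * M" "1 * M \<le> (1 + \<bar>c\<bar> + s) * M"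
    "s * M \<le> (1 + \<bar>c\<bar> + s) * M"
    using s assms(2) by (auto intro!: mult_right_mono)
  \<comment> \<open>Since \<open>1 \<le> M\<close>, the bound on products also dominates the entry
    \<open>c\<close> alone.\<close>
  have "\<bar>c\<bar> * 1 \<le> \<bar>c\<bar> * M" using assms(2) by (intro mult_left_mono) auto
  with le(1) have "\<bar>c\<bar> \<le> (1 + \<bar>c\<bar> + s) * M" by linarith
  then have fits: "fits B c" "fits B M" "fits B (c * M)" "fits B (s * M)" "fits B ((1 + s) * M)"
    using le s assms(2) by (auto intro: fits_mono[OF F] fits_le[OF F] simp: abs_mult)
  have "1 * 1 \<le> (1 + s) * M" using s assms(2) by (intro mult_mono) auto
  then have f1: "fits B (- 1)" using fits(5) by (auto intro: fits_mono)
  have b: "bounded_by (length v) M (\<lambda>r. g (x # r))" for x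
    using Cons.prems(1) bounded_by_Cons by simp
  have IH: "run t B 2 [list_val (map VInt v), tensor_val (length v) (\<lambda>r. g (x # r))]
    (tensor_val (length v) (wedge v (\<lambda>r. g (x # r)))) (wedge_cost (length v))" for x
    by (rule Cons.IH[OF b]) (use fits(5) in \<open>simp add: s_def\<close>)
  have "bounded_by (length v) (s * M) (wedge v (\<lambda>r. g (True # r)))"
    unfolding bounded_by_def s_def using b[of True] by (auto simp: bounded_by_def intro!: wedge_bound)
  then have L: "run t B 1 [list_val (map VInt v), VInt c, tensor_val (length v) (\<lambda>r. g (False # r)), VInt (- 1),
      tensor_val (length v) (wedge v (\<lambda>r. g (True # r)))]
    (tensor_val (length v) (\<lambda>b. c * g (False # b) + (- 1) * wedge v (\<lambda>r. g (True # r)) b)) (lincomb_cost (length v))"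
    by (intro run_lincomb[where M = M and N = "s * M"] b fits f1) (use fits in \<open>simp_all add: fits_def\<close>)
  show ?case
    apply (rule fnI[OF program_nth(3)[unfolded wedge_body_def]])
       apply (simp add: length_program)
      apply (rule ev_intros IH L | simp)+
    done
qed

fun inner_cost :: "nat \<Rightarrow> nat \<Rightarrow> nat" where
  "inner_cost 0 n = wedge_cost n + 5"
| "inner_cost (Suc k) n = 13 + 2 * inner_cost k n"

lemma run_inner:
  assumes "bounded_by (length ds + length v) M F" "1 \<le> M" "fits B ((1 + (\<Sum>x\<leftarrow>v. \<bar>x\<bar>)) * M)"
  shows "run t B 3 [list_val ds, list_val (map VInt v), tensor_val (length ds + length v) F]
    (tensor_val (length ds + length v) (\<lambda>b. wedge v (\<lambda>r. F (take (length ds) b @ r)) (drop (length ds) b)))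
    (inner_cost (length ds) (length v))"
  using assms(1)
proof (induction ds arbitrary: F)
  case Nil
  then have W: "run t B 2 [list_val (map VInt v), tensor_val (length v) F]
    (tensor_val (length v) (wedge v F)) (wedge_cost (length v))"
    using assms by (intro run_wedge) auto
  show ?case
    apply (rule fnI[OF program_nth(4)[unfolded inner_body_def]])
       apply (simp add: length_program)
      apply (rule ev_intros W | simp)+
    done
next
  case (Cons y ds)
  have IH: "run t B 3 [list_val ds, list_val (map VInt v), tensor_val (length ds + length v) (\<lambda>r. F (x # r))]
    (tensor_val (length ds + length v) (\<lambda>b. wedge v (\<lambda>r. F (x # take (length ds) b @ r)) (drop (length ds) b)))
    (inner_cost (length ds) (length v))" for x
    by (rule Cons.IH) (use Cons.prems bounded_by_Cons in auto)
  show ?case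
    apply (rule fnI[OF program_nth(4)[unfolded inner_body_def]])
       apply (simp add: length_program)
      apply (rule ev_intros IH | simp)+
    done
qed

primrec dpowers_cost :: "nat \<Rightarrow> nat" where
  "dpowers_cost 0 = 3"
| "dpowers_cost (Suc k) = 12 + dpowers_cost k"

text \<open>The loop invariant: after \<open>j\<close> steps the running power is
  \<open>x ^ j\<close> and the \<open>j\<close> lower powers stand in front of the
  accumulator.\<close>

lemma run_dpowers_aux:
  assumes "\<bar>x\<bar> \<le> X" "1 \<le> X" "fits B X" "fits B (X ^ (length ds + j))"
  shows "run t B 4 [list_val ds, VInt (x ^ j), VInt x, list_val (map VInt (dpowers j x) @ acc)]
    (list_val (map VInt (dpowers (length ds + j) x) @ acc)) (dpowers_cost (length ds))"
  using assms(4)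
proof (induction ds arbitrary: j)
  case Nil
  show ?case
    apply (rule fnI[OF program_nth(5)[unfolded dpowers_body_def]])
       apply (simp add: length_program)
      apply (rule ev_intros | simp)+
    done
next
  case (Cons y ds)
  have IH: "run t B 4 [list_val ds, VInt (x ^ j * x), VInt x, VCons (VInt (x ^ j)) (list_val (map VInt (dpowers j x) @ acc))]
    (list_val (map VInt (dpowers (length (y # ds) + j) x) @ acc)) (dpowers_cost (length ds))"
    using Cons.IH[of "Suc j"] Cons.prems by (simp add: mult.commute)
  have "\<bar>x ^ j\<bar> \<le> X ^ j" using assms(1) by (simp add: power_abs power_mono)
  also have "\<dots> \<le> X ^ (length (y # ds) + j)" using assms(2) by (intro power_increasing) auto
  finally have f: "fits B x" "fits B (x ^ j)"
    using assms(1,2) by (auto intro: fits_mono[OF assms(3)] fits_mono[OF Cons.prems])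
  show ?case
    apply (rule fnI[OF program_nth(5)[unfolded dpowers_body_def]])
       apply (simp add: length_program)
      apply (rule ev_intros IH f | simp)+
    done
qed

lemma run_dpowers:
  assumes "\<bar>x\<bar> \<le> X" "1 \<le> X" "fits B X" "fits B (X ^ length ds)"
  shows "run t B 4 [list_val ds, VInt 1, VInt x, list_val acc]
    (list_val (map VInt (dpowers (length ds) x) @ acc)) (dpowers_cost (length ds))"
  using run_dpowers_aux[where j = 0, of x X B ds] assms by simp

text \<open>One plus a bound on the sum of the absolute entries of a Vandermonde vector, which is
  the factor that \<open>run_wedge\<close> requires to fit.\<close>

definition vec_bound :: "nat \<Rightarrow> int \<Rightarrow> int" where
  "vec_bound k X = 1 + int k * X ^ k"

lemma sum_dpowers_le: "\<bar>x\<bar> \<le> X \<Longrightarrow> 1 \<le> X \<Longrightarrow> (\<Sum>y\<leftarrow>dpowers k x. \<bar>y\<bar>) \<le> int k * X ^ k"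
proof (induction k)
  case (Suc k)
  have "\<bar>x ^ k\<bar> \<le> X ^ k" using Suc.prems by (simp add: power_abs power_mono)
  also have le: "X ^ k \<le> X ^ Suc k" using Suc.prems by (intro power_increasing) auto
  finally have "\<bar>x ^ k\<bar> \<le> X ^ Suc k" .
  moreover have "int k * X ^ k \<le> int k * X ^ Suc k" by (rule mult_left_mono[OF le]) simp
  ultimately show ?case using Suc.IH[OF Suc.prems] by (simp add: algebra_simps)
qed simp

lemma vec_bound_ge: "1 \<le> X \<Longrightarrow> 1 \<le> vec_bound k X"
  by (simp add: vec_bound_def)

lemma bounded_by_mono: "bounded_by d M g \<Longrightarrow> M \<le> N \<Longrightarrow> bounded_by d N g"
  by (force simp: bounded_by_def)

lemma bounded_by_inner:
  assumes "bounded_by (2 * k) M F" "\<bar>x\<bar> \<le> X" "1 \<le> X" "0 \<le> M"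
  shows "bounded_by (2 * k) (vec_bound k X * M)
    (\<lambda>b. wedge (dpowers k x) (\<lambda>r. F (take k b @ r)) (drop k b))"
  unfolding bounded_by_def
proof (intro allI impI)
  fix b :: "bool list" assume b: "length b = 2 * k"
  have "\<bar>wedge (dpowers k x) (\<lambda>r. F (take k b @ r)) (drop k b)\<bar> \<le> (\<Sum>y\<leftarrow>dpowers k x. \<bar>y\<bar>) * M"
    by (rule wedge_bound) (use b assms(1) in \<open>simp_all add: bounded_by_def\<close>)
  also have "\<dots> \<le> vec_bound k X * M"
    using sum_dpowers_le[OF assms(2,3), of k] assms(4) by (intro mult_right_mono) (auto simp: vec_bound_def)
  finally show "\<bar>wedge (dpowers k x) (\<lambda>r. F (take k b @ r)) (drop k b)\<bar> \<le> vec_bound k X * M" .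
qed

lemma bounded_by_ext_op:
  assumes "bounded_by (2 * k) M F" "\<bar>x\<bar> \<le> X" "1 \<le> X" "0 \<le> M"
  shows "bounded_by (2 * k) ((vec_bound k X)\<^sup>2 * M) (ext_op k x F)"
  unfolding bounded_by_def
proof (intro allI impI)
  fix b :: "bool list" assume b: "length b = 2 * k"
  have "\<bar>ext_op k x F b\<bar> \<le> (\<Sum>y\<leftarrow>dpowers k x @ replicate k 0. \<bar>y\<bar>) * (vec_bound k X * M)"
    unfolding ext_op_def
    by (rule wedge_bound) (use b bounded_by_inner[OF assms] in \<open>simp_all add: bounded_by_def\<close>)
  also have "\<dots> \<le> vec_bound k X * (vec_bound k X * M)"
    using sum_dpowers_le[OF assms(2,3), of k] assms(3,4) vec_bound_ge[OF assms(3), of k]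
    by (intro mult_right_mono) (auto simp: vec_bound_def sum_list_replicate)
  finally show "\<bar>ext_op k x F b\<bar> \<le> (vec_bound k X)\<^sup>2 * M" by (simp add: power2_eq_square mult.assoc)
qed

lemma bounded_by_add: "bounded_by d M f \<Longrightarrow> bounded_by d N g \<Longrightarrow> bounded_by d (M + N) (\<lambda>b. f b + g b)"
  by (force simp: bounded_by_def)

text \<open>Each bit multiplies the bound by \<open>1 + (vec_bound k X)\<^sup>2\<close>: the two
  wedge products of \<open>ext_op\<close> contribute one factor \<open>vec_bound k X\<close> each,
  and the summand 1 is for the old tensor.\<close>

lemma bounded_by_row_step:
  assumes "bounded_by (2 * k) M F" "0 \<le> x" "x + int (length r) \<le> X" "1 \<le> X" "0 \<le> M"
  shows "bounded_by (2 * k) ((1 + (vec_bound k X)\<^sup>2) ^ length r * M) (row_step k r x F)"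
  using assms
proof (induction r arbitrary: x F M)
  case (Cons a r)
  have "bounded_by (2 * k) ((1 + (vec_bound k X)\<^sup>2) * M) (if a then \<lambda>b. F b + ext_op k x F b else F)"
  proof (cases a)
    case True
    then show ?thesis using bounded_by_add[OF Cons.prems(1) bounded_by_ext_op[OF Cons.prems(1), of x X]] Cons.prems
      by (simp add: algebra_simps)
  next
    case False
    have "1 * M \<le> (1 + (vec_bound k X)\<^sup>2) * M" using Cons.prems(5) by (intro mult_right_mono) auto
    with False Cons.prems(1) show ?thesis by (auto intro: bounded_by_mono)
  qed
  from Cons.IH[OF this, of "x + 1"] Cons.prems show ?case by (simp add: mult_ac)
qed simp

lemma bounded_by_rows_step:
  assumes "bounded_by (2 * k) M F" "\<forall>r\<in>set rows. length r = n" "int n \<le> X" "1 \<le> X" "0 \<le> M"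
  shows "bounded_by (2 * k) (int (length rows) * ((1 + (vec_bound k X)\<^sup>2) ^ n * M)) (rows_step k rows F)"
  using assms(2)
proof (induction rows)
  case (Cons r rows)
  have "bounded_by (2 * k) ((1 + (vec_bound k X)\<^sup>2) ^ n * M) (row_step k r 0 F)"
    using bounded_by_row_step[OF assms(1), of 0 r X] Cons.prems assms by simp
  from bounded_by_add[OF this Cons.IH] Cons.prems show ?case by (simp add: algebra_simps)
qed (simp add: bounded_by_def)

fun ext_cost :: "nat \<Rightarrow> nat" where
  "ext_cost k = 50 + lincomb_cost (2 * k) + wedge_cost (2 * k) + inner_cost k k + 2 * dpowers_cost k"

primrec row_cost :: "nat \<Rightarrow> nat \<Rightarrow> nat" where
  "row_cost k 0 = 3"
| "row_cost k (Suc n) = ext_cost k + row_cost k n"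

lemma bool_val_simps: "bool_val True = VInt 1" "bool_val False = VInt 0"
  by (simp_all add: bool_val_def)

abbreviation zeros_val :: "nat \<Rightarrow> val" where
  "zeros_val k \<equiv> list_val (replicate k (VInt 0))"

lemma run_row:
  assumes "bounded_by (2 * k) M F" "1 \<le> M" "0 \<le> x" "x + int (length r) \<le> X" "1 \<le> X" "fits B X"
    "fits B ((1 + (vec_bound k X)\<^sup>2) ^ length r * M)"
  shows "run t B 5 [zeros_val k, zeros_val (2 * k), list_val (map bool_val r), VInt x, tensor_val (2 * k) F]
    (tensor_val (2 * k) (row_step k r x F)) (row_cost k (length r))"
  using assms(1-4,7)
proof (induction r arbitrary: x F M)
  case Nil
  show ?case
    apply (rule fnI[OF program_nth(6)[unfolded row_body_def]])
       apply (simp add: length_program)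
      apply (rule ev_intros | simp)+
    done
next
  case (Cons a r)
  define W where "W = vec_bound k X"
  have W: "1 \<le> W" using vec_bound_ge[OF assms(5)] by (simp add: W_def)
  have x: "0 \<le> x" "\<bar>x\<bar> \<le> X" using Cons.prems by auto
  have fx: "fits B x" "fits B 1" using x assms(5) by (auto intro: fits_mono[OF assms(6)])
  define F' where "F' = (if a then \<lambda>b. F b + ext_op k x F b else F)"
  have F'b: "bounded_by (2 * k) ((1 + W\<^sup>2) * M) F'"
    unfolding W_def F'_def
    using bounded_by_row_step[OF Cons.prems(1), of x "[a]" X] Cons.prems assms(5) by simp
  have "1 * 1 \<le> (1 + W\<^sup>2) * M" using Cons.prems(2) by (intro mult_mono) auto
  then have IH: "run t B 5 [zeros_val k, zeros_val (2 * k), list_val (map bool_val r), VInt (x + 1),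
      tensor_val (2 * k) F'] (tensor_val (2 * k) (row_step k (a # r) x F)) (row_cost k (length r))"
    using Cons.IH[OF F'b, of "x + 1"] Cons.prems by (simp add: F'_def W_def mult_ac)
  show ?case
  proof (cases a)
    case False
    then have "F' = F" by (simp add: F'_def)
    show ?thesis
      apply (rule fnI[OF program_nth(6)[unfolded row_body_def]])
         apply (simp add: length_program)
        apply (rule ev_intros ev_If_True IH[unfolded \<open>F' = F\<close>] fx fits_0 | simp add: bool_val_simps False)+
      done
  next
    case True
    have "(1 + W\<^sup>2) * M \<le> (1 + W\<^sup>2) ^ length (a # r) * M"
      using Cons.prems(2) self_le_power[of "1 + W\<^sup>2" "length (a # r)"] by (intro mult_right_mono) auto
    then have FW: "fits B ((1 + W\<^sup>2) * M)"
      using Cons.prems(2,5) by (auto intro!: fits_le[OF Cons.prems(5)] simp: W_def)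
    \<comment> \<open>All intermediate bounds lie in the chain
      \<open>M \<le> W * M \<le> W\<^sup>2 * M \<le> (1 + W\<^sup>2) * M\<close>, whose last member
      fits.\<close>
    have "M \<le> W * M" using Cons.prems(2) W by (simp add: mult_le_cancel_right1)
    moreover have "W * M \<le> W\<^sup>2 * M"
      using W Cons.prems(2) by (intro mult_right_mono) (simp_all add: self_le_power)
    moreover have "(1 + W\<^sup>2) * M = M + W\<^sup>2 * M" by (simp add: algebra_simps)
    ultimately have "M \<le> (1 + W\<^sup>2) * M" "W * M \<le> (1 + W\<^sup>2) * M" "W\<^sup>2 * M \<le> (1 + W\<^sup>2) * M"
      using Cons.prems(2) by linarith+
    then have fits: "fits B M" "fits B (W * M)" "fits B (W\<^sup>2 * M)"
      using Cons.prems(2) W by (auto intro: fits_le[OF FW])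
    have "X ^ k \<le> W"
    \<comment> \<open>For \<open>k = 0\<close> the summand \<open>int k * X ^ k\<close> of the bound
      is zero, but then \<open>X ^ k\<close> is 1.\<close>
    proof (cases k)
      case (Suc k')
      have "1 * X ^ k \<le> int k * X ^ k" using assms(5) Suc by (intro mult_right_mono) auto
      then show ?thesis by (simp add: W_def vec_bound_def)
    qed (use W in simp)
    moreover have "W * 1 \<le> W * M" using W Cons.prems(2) by (intro mult_left_mono) auto
    ultimately have fX: "fits B (X ^ k)"
      using assms(5) by (intro fits_le[OF fits(2)]) auto
    have s: "0 \<le> (\<Sum>y\<leftarrow>dpowers k x. \<bar>y\<bar>)" "1 + (\<Sum>y\<leftarrow>dpowers k x. \<bar>y\<bar>) \<le> W"
      using sum_list_abs_nonneg sum_dpowers_le[OF x(2) assms(5), of k] by (auto simp: W_def vec_bound_def)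
    have "(1 + (\<Sum>y\<leftarrow>dpowers k x. \<bar>y\<bar>)) * M \<le> W * M"
      using s Cons.prems(2) by (intro mult_right_mono) auto
    then have f1: "fits B ((1 + (\<Sum>y\<leftarrow>dpowers k x. \<bar>y\<bar>)) * M)"
      using s Cons.prems(2) by (intro fits_le[OF fits(2)]) auto
    have "(1 + (\<Sum>y\<leftarrow>dpowers k x. \<bar>y\<bar>)) * (W * M) \<le> W * (W * M)"
      using s Cons.prems(2) W by (intro mult_right_mono) auto
    then have f2: "fits B ((1 + (\<Sum>y\<leftarrow>dpowers k x @ replicate k 0. \<bar>y\<bar>)) * (W * M))"
      using s Cons.prems(2) W
      by (intro fits_le[OF fits(3)]) (auto simp: power2_eq_square mult.assoc sum_list_replicate)
    define G where "G = (\<lambda>b. wedge (dpowers k x) (\<lambda>r. F (take k b @ r)) (drop k b))"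
    \<comment> \<open>The padded vector acts on the first tensor factor, the unpadded one in
      \<open>D2\<close> on the second.\<close>
    have D1: "run t B 4 [zeros_val k, VInt 1, VInt x, zeros_val k]
        (list_val (map VInt (dpowers k x @ replicate k 0))) (dpowers_cost k)"
      using run_dpowers[OF x(2) assms(5,6), of "replicate k (VInt 0)"] fX by simp
    have D2: "run t B 4 [zeros_val k, VInt 1, VInt x, VNil]
        (list_val (map VInt (dpowers k x))) (dpowers_cost k)"
      using run_dpowers[OF x(2) assms(5,6), of "replicate k (VInt 0)" _ "[]"] fX by simp
    have I: "run t B 3 [zeros_val k, list_val (map VInt (dpowers k x)), tensor_val (2 * k) F]
        (tensor_val (2 * k) G) (inner_cost k k)"
      using run_inner[of "replicate k (VInt 0)" "dpowers k x" M F B t] Cons.prems(1,2) f1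
      by (simp add: mult_2 G_def)
    have Gb: "bounded_by (2 * k) (W * M) G"
      unfolding G_def W_def using bounded_by_inner[OF Cons.prems(1) x(2) assms(5)] Cons.prems(2) by simp
    have "1 * 1 \<le> W * M" using W Cons.prems(2) by (intro mult_mono) auto
    then have E: "run t B 2 [list_val (map VInt (dpowers k x @ replicate k 0)), tensor_val (2 * k) G]
        (tensor_val (2 * k) (ext_op k x F)) (wedge_cost (2 * k))"
      using run_wedge[of "dpowers k x @ replicate k 0" "W * M" G B t] Gb f2
      by (simp add: mult_2 ext_op_def G_def)
    have L: "run t B 1 [zeros_val (2 * k), VInt 1, tensor_val (2 * k) F, VInt 1, tensor_val (2 * k) (ext_op k x F)]
        (tensor_val (2 * k) F') (lincomb_cost (2 * k))"
      using run_lincomb[of "replicate (2 * k) (VInt 0)" "2 * k" M F "W\<^sup>2 * M" "ext_op k x F" B 1 1 t]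
        bounded_by_ext_op[OF Cons.prems(1) x(2) assms(5)] Cons.prems(1,2) fits fx
      by (simp add: W_def F'_def True)
    show ?thesis
      apply (rule fnI[OF program_nth(6)[unfolded row_body_def]])
         apply (simp add: length_program)
        apply (rule ev_intros ev_If_False IH fx fits_0 D1 D2 I E L | simp add: bool_val_simps True)+
      done
  qed
qed

primrec zero_cost :: "nat \<Rightarrow> nat" where
  "zero_cost 0 = 3"
| "zero_cost (Suc d) = 10 + zero_cost d"

lemma run_zero: "run t B 8 [list_val ds] (tensor_val (length ds) (\<lambda>_. 0)) (zero_cost (length ds))"
proof (induction ds)
  case Nil
  show ?case
    apply (rule fnI[OF program_nth(9)[unfolded zero_body_def]])
       apply (simp add: length_program)
      apply (rule ev_intros | simp)+
    done
next
  case (Cons y ds)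
  show ?case
    apply (rule fnI[OF program_nth(9)[unfolded zero_body_def]])
       apply (simp add: length_program)
      apply (rule ev_intros Cons.IH | simp)+
    done
qed

primrec one_cost :: "nat \<Rightarrow> nat" where
  "one_cost 0 = 3"
| "one_cost (Suc d) = 10 + one_cost d + zero_cost d"

lemma ext_unit_simps: "ext_unit [] = 1" "ext_unit (False # b) = ext_unit b" "ext_unit (True # b) = 0"
  by (simp_all add: ext_unit_def)

lemma run_unit: "run t B 9 [list_val ds] (tensor_val (length ds) ext_unit) (one_cost (length ds))"
proof (induction ds)
  case Nil
  show ?case
    apply (rule fnI[OF program_nth(10)[unfolded unit_body_def]])
       apply (simp add: length_program)
      apply (rule ev_intros | simp add: ext_unit_simps)+
    done
next
  case (Cons y ds)
  show ?case
    apply (rule fnI[OF program_nth(10)[unfolded unit_body_def]])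
       apply (simp add: length_program)
      apply (rule ev_intros Cons.IH run_zero | simp add: ext_unit_simps)+
    done
qed

primrec top_cost :: "nat \<Rightarrow> nat" where
  "top_cost 0 = 3"
| "top_cost (Suc d) = 10 + top_cost d"

lemma run_top:
  "run t B 10 [list_val ds, tensor_val (length ds) F] (VInt (F (replicate (length ds) True))) (top_cost (length ds))"
proof (induction ds arbitrary: F)
  case Nil
  show ?case
    apply (rule fnI[OF program_nth(11)[unfolded top_body_def]])
       apply (simp add: length_program)
      apply (rule ev_intros | simp)+
    done
next
  case (Cons y ds)
  show ?case
    apply (rule fnI[OF program_nth(11)[unfolded top_body_def]])
       apply (simp add: length_program)
      apply (rule ev_intros Cons.IH | simp)+
    done
qed

section \<open>Auxiliary routines on lists and numbers\<close>

primrec zeros_cost :: "nat \<Rightarrow> nat" where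
  "zeros_cost 0 = 4"
| "zeros_cost (Suc j) = 12 + zeros_cost j"

lemma run_zeros: "1 \<le> B \<Longrightarrow> fits B (int j) \<Longrightarrow> run t B 11 [VInt (int j)] (zeros_val j) (zeros_cost j)"
proof (induction j)
  case 0
  show ?case
    apply (rule fnI[OF program_nth(12)[unfolded zeros_body_def]])
       apply (simp add: length_program)
      apply (rule ev_intros ev_If_True fits_0 | simp)+
    done
next
  case (Suc j)
  have f: "fits B (int (Suc j))" "fits B 1" "fits B (int j)"
    using Suc.prems by (auto intro: fits_mono[OF Suc.prems(2)])
  have IH: "run t B 11 [VInt (int (Suc j) - 1)] (zeros_val j) (zeros_cost j)"
    using Suc.IH[OF Suc.prems(1) f(3)] by simp
  show ?case
    apply (rule fnI[OF program_nth(12)[unfolded zeros_body_def]])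
       apply (simp add: length_program)
      apply (rule ev_intros ev_If_False fits_0 IH f | simp del: of_nat_Suc)+
    done
qed

primrec power_cost :: "nat \<Rightarrow> nat" where
  "power_cost 0 = 4"
| "power_cost (Suc j) = 13 + power_cost j"

lemma run_power:
  "1 \<le> b \<Longrightarrow> fits B (int j) \<Longrightarrow> fits B (b ^ j) \<Longrightarrow> run t B 12 [VInt b, VInt (int j)] (VInt (b ^ j)) (power_cost j)"
proof (induction j)
  case 0
  show ?case
    apply (rule fnI[OF program_nth(13)[unfolded power_body_def]])
       apply (simp add: length_program)
      apply (rule ev_intros ev_If_True fits_0 | simp)+
    done
next
  case (Suc j)
  have "b \<le> b ^ Suc j" "b ^ j \<le> b ^ Suc j"
    using Suc.prems(1) power_increasing[of j "Suc j" b] by (simp_all add: self_le_power del: power_Suc)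
  then have f: "fits B (int (Suc j))" "fits B 1" "fits B (int j)" "fits B b" "fits B (b ^ j)"
    using Suc.prems(1) by (auto intro: fits_mono[OF Suc.prems(2)] fits_le[OF Suc.prems(3)] simp del: power_Suc)
  have IH: "run t B 12 [VInt b, VInt (int (Suc j) - 1)] (VInt (b ^ j)) (power_cost j)"
    using Suc.IH[OF Suc.prems(1) f(3,5)] by simp
  show ?case
    apply (rule fnI[OF program_nth(13)[unfolded power_body_def]])
       apply (simp add: length_program)
      apply (rule ev_intros ev_If_False fits_0 IH f | simp del: of_nat_Suc)+
    done
qed

primrec longer_cost :: "nat \<Rightarrow> nat" where
  "longer_cost 0 = 10"
| "longer_cost (Suc j) = 14 + longer_cost j"

lemma run_longer:
  "fits B (int L) \<Longrightarrow> fits B 1 \<Longrightarrow> run t B 13 [VInt (int L), list_val vs] (bool_val (L < length vs)) (longer_cost L)"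
proof (induction L arbitrary: vs)
  case 0
  show ?case
  proof (cases vs)
    case [simp]: Nil
    show ?thesis
      apply (rule fnI[OF program_nth(14)[unfolded longer_body_def]])
         apply (simp add: length_program)
        apply (rule ev_intros ev_If_True fits_0 | simp add: bool_val_simps)+
      done
  next
    case [simp]: (Cons v vs)
    show ?thesis
      apply (rule fnI[OF program_nth(14)[unfolded longer_body_def]])
         apply (simp add: length_program)
        apply (rule ev_intros ev_If_True fits_0 | simp add: bool_val_simps)+
      done
  qed
next
  case (Suc L)
  show ?case
  proof (cases vs)
    case [simp]: Nil
    show ?thesis
      apply (rule fnI[OF program_nth(14)[unfolded longer_body_def]])
         apply (simp add: length_program)
        apply (rule ev_intros ev_If_True fits_0 | simp add: bool_val_simps)+
      done
  next
    case [simp]: (Cons v ws)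
    have IH: "run t B 13 [VInt (int (Suc L) - 1), list_val ws] (bool_val (L < length ws)) (longer_cost L)"
      using Suc.IH[of ws] Suc.prems fits_mono[OF Suc.prems(1), of "int L"] by simp
    show ?thesis
      apply (rule fnI[OF program_nth(14)[unfolded longer_body_def]])
         apply (simp add: length_program)
        apply (rule ev_intros ev_If_False fits_0 IH Suc.prems | simp del: of_nat_Suc)+
      done
  qed
qed

section \<open>Sums over the family and their iteration\<close>

primrec rows_cost :: "nat \<Rightarrow> nat \<Rightarrow> nat \<Rightarrow> nat" where
  "rows_cost k n 0 = 6 + zero_cost (2 * k)"
| "rows_cost k n (Suc R) = 24 + lincomb_cost (2 * k) + row_cost k n + rows_cost k n R"

text \<open>The factor by which a single row with \<open>n\<close> entries can enlarge the
  coefficients.\<close>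

definition growth :: "nat \<Rightarrow> nat \<Rightarrow> int \<Rightarrow> int" where
  "growth k n X = (1 + (vec_bound k X)\<^sup>2) ^ n"

lemma growth_ge: "1 \<le> growth k n X"
  by (simp add: growth_def one_le_power)

abbreviation rows_val :: "bool list list \<Rightarrow> val" where
  "rows_val rows \<equiv> list_val (map (\<lambda>r. list_val (map bool_val r)) rows)"

lemma run_rows:
  assumes "bounded_by (2 * k) M F" "1 \<le> M" "\<forall>r\<in>set rows. length r = n" "int n \<le> X" "1 \<le> X" "fits B X"
    "fits B ((int (length rows) + 1) * growth k n X * M)"
  shows "run t B 6 [zeros_val k, zeros_val (2 * k), rows_val rows, tensor_val (2 * k) F]
    (tensor_val (2 * k) (rows_step k rows F)) (rows_cost k n (length rows))"
  using assms(3,7)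
proof (induction rows)
  case Nil
  have Z: "run t B 8 [zeros_val (2 * k)] (tensor_val (2 * k) (\<lambda>_. 0)) (zero_cost (2 * k))"
    using run_zero[of t B "replicate (2 * k) (VInt 0)"] by simp
  show ?case
    apply (rule fnI[OF program_nth(7)[unfolded rows_body_def]])
       apply (simp add: length_program)
      apply (rule ev_intros Z | simp)+
    done
next
  case (Cons r rows)
  define g where "g = growth k n X * M"
  have "1 * 1 \<le> growth k n X * M" using growth_ge[of k n X] assms(2) by (intro mult_mono) auto
  then have g: "1 \<le> g" by (simp add: g_def)
  have F: "fits B ((int (length rows) + 2) * g)" using Cons.prems(2) by (simp add: g_def mult.assoc add.commute)
  have le: "1 * g \<le> (int (length rows) + 2) * g" "int (length rows) * g \<le> (int (length rows) + 2) * g"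
      "(int (length rows) + 1) * g \<le> (int (length rows) + 2) * g"
    using g by (auto intro!: mult_right_mono)
  then have fits: "fits B g" "fits B (int (length rows) * g)" "fits B ((int (length rows) + 1) * g)"
    using g by (auto intro!: fits_le[OF F])
  have f1: "fits B 1" using assms(5) by (intro fits_le[OF assms(6)]) auto
  have IH: "run t B 6 [zeros_val k, zeros_val (2 * k), rows_val rows, tensor_val (2 * k) F]
    (tensor_val (2 * k) (rows_step k rows F)) (rows_cost k n (length rows))"
    by (rule Cons.IH) (use Cons.prems(1) fits(3) in \<open>simp_all add: g_def mult.assoc\<close>)
  have R: "run t B 5 [zeros_val k, zeros_val (2 * k), list_val (map bool_val r), VInt 0, tensor_val (2 * k) F]
    (tensor_val (2 * k) (row_step k r 0 F)) (row_cost k n)"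
    using run_row[OF assms(1,2), of 0 r X B t] Cons.prems(1) assms(4-6) fits(1) by (simp add: g_def growth_def)
  have b: "bounded_by (2 * k) g (row_step k r 0 F)"
    using bounded_by_row_step[OF assms(1), of 0 r X] Cons.prems(1) assms by (simp add: g_def growth_def)
  have b': "bounded_by (2 * k) (int (length rows) * g) (rows_step k rows F)"
    using bounded_by_rows_step[OF assms(1), of rows n X] Cons.prems(1) assms by (simp add: g_def growth_def)
  have L: "run t B 1 [zeros_val (2 * k), VInt 1, tensor_val (2 * k) (row_step k r 0 F), VInt 1,
      tensor_val (2 * k) (rows_step k rows F)]
    (tensor_val (2 * k) (rows_step k (r # rows) F)) (lincomb_cost (2 * k))"
    using run_lincomb[of "replicate (2 * k) (VInt 0)", OF _ b b' f1 f1 fits(1,2)] fits by simp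
  show ?case
    apply (rule fnI[OF program_nth(7)[unfolded rows_body_def]])
       apply (simp add: length_program)
      apply (rule ev_intros IH R L | simp)+
    done
qed

primrec iterate_cost :: "nat \<Rightarrow> nat \<Rightarrow> nat \<Rightarrow> nat \<Rightarrow> nat" where
  "iterate_cost k n R 0 = 6"
| "iterate_cost k n R (Suc m) = 26 + rows_cost k n R + iterate_cost k n R m"

text \<open>The factor \<open>length rows + 1\<close> keeps the bound at least 1 even for an empty
  list of rows, as the iteration needs.\<close>

lemma bounded_by_rows_step':
  assumes "bounded_by (2 * k) M F" "\<forall>r\<in>set rows. length r = n" "int n \<le> X" "1 \<le> X" "0 \<le> M"
  shows "bounded_by (2 * k) ((int (length rows) + 1) * growth k n X * M) (rows_step k rows F)"
proof -
  have "int (length rows) * (growth k n X * M) \<le> (int (length rows) + 1) * (growth k n X * M)"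
    using growth_ge[of k n X] assms(5) by (intro mult_right_mono) auto
  then show ?thesis
    using bounded_by_rows_step[OF assms] by (auto simp: growth_def mult.assoc intro: bounded_by_mono)
qed

lemma bounded_by_iterate:
  assumes "bounded_by (2 * k) M F" "\<forall>r\<in>set rows. length r = n" "int n \<le> X" "1 \<le> X" "0 \<le> M"
  shows "bounded_by (2 * k) (((int (length rows) + 1) * growth k n X) ^ m * M) ((rows_step k rows ^^ m) F)"
proof (induction m)
  case (Suc m)
  have "0 \<le> ((int (length rows) + 1) * growth k n X) ^ m * M"
    using growth_ge[of k n X] assms(5) by simp
  from bounded_by_rows_step'[OF Suc assms(2-4) this] show ?case by (simp add: mult_ac)
qed (use assms in simp)

lemma run_iterate:
  assumes "\<forall>r\<in>set rows. length r = n" "int n \<le> X" "1 \<le> X" "fits B X"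
    "bounded_by (2 * k) M F" "1 \<le> M" "fits B (int m)" "fits B (((int (length rows) + 1) * growth k n X) ^ m * M)"
  shows "run t B 7 [VInt (int m), zeros_val k, zeros_val (2 * k), rows_val rows, tensor_val (2 * k) F]
    (tensor_val (2 * k) ((rows_step k rows ^^ m) F)) (iterate_cost k n (length rows) m)"
  using assms(5-8)
proof (induction m arbitrary: M F)
  case 0
  show ?case
    apply (rule fnI[OF program_nth(8)[unfolded iterate_body_def]])
       apply (simp add: length_program)
      apply (rule ev_intros ev_If_True fits_0 | simp)+
    done
next
  case (Suc m)
  define S where "S = (int (length rows) + 1) * growth k n X"
  have "1 * 1 \<le> (int (length rows) + 1) * growth k n X"
    using growth_ge[of k n X] by (intro mult_mono) auto
  then have S: "1 \<le> S" by (simp add: S_def)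
  have "S * 1 \<le> S * M" using S Suc.prems(2) by (intro mult_left_mono) auto
  then have SM: "1 \<le> S * M" using S by linarith
  have eq: "S ^ Suc m * M = S ^ m * (S * M)" by (simp add: mult_ac)
  have "1 * (S * M) \<le> S ^ m * (S * M)" using S SM by (intro mult_right_mono) (auto simp: one_le_power)
  then have fSM: "fits B (S * M)"
    using SM by (intro fits_le[OF Suc.prems(4)[folded S_def, unfolded eq]]) auto
  have f: "fits B 1" "fits B (int (Suc m))" "fits B (int m)"
    using Suc.prems(3) assms(3) by (auto intro: fits_mono[OF Suc.prems(3)])
  have b: "bounded_by (2 * k) (S * M) (rows_step k rows F)"
    using bounded_by_rows_step'[OF Suc.prems(1) assms(1-3)] Suc.prems(2) by (simp add: S_def)
  have R: "run t B 6 [zeros_val k, zeros_val (2 * k), rows_val rows, tensor_val (2 * k) F]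
      (tensor_val (2 * k) (rows_step k rows F)) (rows_cost k n (length rows))"
    using run_rows[OF Suc.prems(1,2) assms(1-4)] fSM by (simp add: S_def)
  have IH: "run t B 7 [VInt (int (Suc m) - 1), zeros_val k, zeros_val (2 * k), rows_val rows,
      tensor_val (2 * k) (rows_step k rows F)]
      (tensor_val (2 * k) ((rows_step k rows ^^ Suc m) F)) (iterate_cost k n (length rows) m)"
    using Suc.IH[OF b SM f(3)] Suc.prems(4)[folded S_def, unfolded eq, unfolded S_def]
    by (simp add: funpow_swap1 S_def)
  show ?case
    apply (rule fnI[OF program_nth(8)[unfolded iterate_body_def]])
       apply (simp add: length_program)
      apply (rule ev_intros ev_If_False fits_0 R IH f | simp del: of_nat_Suc funpow.simps)+
    done
qed

section \<open>Residues, the union test and the search\<close>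

primrec neg_mod_cost :: "nat \<Rightarrow> nat" where
  "neg_mod_cost 0 = 8"
| "neg_mod_cost (Suc j) = 12 + neg_mod_cost j"

text \<open>Subtracting \<open>t\<close> preserves the residue of \<open>- x\<close>. As
  \<open>- int t < x\<close> is invariant, \<open>- x\<close> is itself the residue as soon as
  \<open>x \<le> 0\<close>. The number \<open>j\<close> only bounds the steps.\<close>

lemma run_neg_mod:
  assumes "1 \<le> t" "fits B (int t)"
  shows "- int t < x \<Longrightarrow> nat x \<le> j \<Longrightarrow> fits B x \<Longrightarrow>
    run t B 14 [VInt x] (VInt ((- x) mod int t)) (neg_mod_cost j)"
proof (induction j arbitrary: x)
  case (0 x)
  have f: "fits B x" using 0 by simp
  have le: "x \<le> 0" using 0 by simp
  show ?case
    apply (rule fnI[OF program_nth(15)[unfolded neg_mod_body_def]])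
       apply (simp add: length_program)
      apply (rule ev_intros ev_If_True fits_0 f le | simp)+
    using 0 by auto
next
  case (Suc j x)
  show ?case
  proof (cases "x \<le> 0")
    case True
    then have "nat x \<le> j" by simp
    from Suc.IH[OF Suc.prems(1) this Suc.prems(3)] show ?thesis by (rule fn_eq) auto
  next
    case False
    have "fits B (x - int t)"
    proof -
      have "\<bar>x\<bar> < 2 ^ B" "\<bar>int t\<bar> < 2 ^ B" using Suc.prems(3) assms(2) by (simp_all only: fits_def)
      then show ?thesis unfolding fits_def using False assms(1) by linarith
    qed
    then have IH: "run t B 14 [VInt (x - int t)] (VInt ((- (x - int t)) mod int t)) (neg_mod_cost j)"
      using False Suc.prems assms(1) by (intro Suc.IH) auto
    have eq: "(- (x - int t)) mod int t = (- x) mod int t"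
      by (metis minus_diff_eq mod_add_self1 uminus_add_conv_diff add.commute)
    show ?thesis
      apply (rule fnI[OF program_nth(15)[unfolded neg_mod_body_def]])
         apply (simp add: length_program)
        apply (rule ev_intros ev_If_False fits_0 IH[unfolded eq] Suc.prems assms False | simp)+
      done
  qed
qed

definition test_cost :: "nat \<Rightarrow> nat \<Rightarrow> nat \<Rightarrow> nat \<Rightarrow> nat" where
  "test_cost k n R m = 60 + zeros_cost k + zeros_cost (2 * k) + top_cost (2 * k) + one_cost (2 * k)
     + iterate_cost k n R m"

lemma run_test:
  assumes "\<forall>r\<in>set rows. length r = n" "int n \<le> X" "1 \<le> X" "fits B X" "fits B (int m)" "fits B (int (2 * k))"
    "fits B (((int (length rows) + 1) * growth k n X) ^ m)"
  shows "run t B 15 [VInt (int m), VInt (int k), rows_val rows] (bool_val (union_test rows m k))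
    (test_cost k n (length rows) m)"
proof -
  define F where "F = (rows_step k rows ^^ m) ext_unit"
  define x where "x = F (replicate (2 * k) True)"
  have f: "fits B 1" "fits B (int k)"
    using assms(3) by (auto intro: fits_mono[OF assms(4)] fits_mono[OF assms(6)])
  then have "1 \<le> B" by (cases B) (auto simp: fits_def)
  have bu: "bounded_by (2 * k) 1 ext_unit" by (simp add: bounded_by_def ext_unit_def)
  have Z1: "run t B 11 [VInt (int k)] (zeros_val k) (zeros_cost k)"
    by (rule run_zeros[OF \<open>1 \<le> B\<close> f(2)])
  have Z2: "run t B 11 [VInt (int k + int k)] (zeros_val (2 * k)) (zeros_cost (2 * k))"
    using run_zeros[OF \<open>1 \<le> B\<close> assms(6)] by simp
  have U: "run t B 9 [zeros_val (2 * k)] (tensor_val (2 * k) ext_unit) (one_cost (2 * k))"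
    using run_unit[of t B "replicate (2 * k) (VInt 0)"] by simp
  have I: "run t B 7 [VInt (int m), zeros_val k, zeros_val (2 * k), rows_val rows, tensor_val (2 * k) ext_unit]
      (tensor_val (2 * k) F) (iterate_cost k n (length rows) m)"
    using run_iterate[OF assms(1-4) bu _ assms(5)] assms(7) by (simp add: F_def)
  have T: "run t B 10 [zeros_val (2 * k), tensor_val (2 * k) F] (VInt x) (top_cost (2 * k))"
    using run_top[of t B "replicate (2 * k) (VInt 0)" F] by (simp add: x_def)
  \<comment> \<open>The top coefficient is compared with 0 at the end, so it has to fit as
    well.\<close>
  have "\<bar>x\<bar> \<le> ((int (length rows) + 1) * growth k n X) ^ m"
    using bounded_by_iterate[OF bu assms(1-3), of m] by (simp add: bounded_by_def x_def F_def)
  then have fx: "fits B x" using assms(7) by (auto intro: fits_mono)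
  have x: "0 < x \<longleftrightarrow> union_test rows m k"
    unfolding x_def F_def by (rule top_coefficient_pos_iff)
  show ?thesis
  proof (cases "union_test rows m k")
    case True
    then have "\<not> x \<le> 0" using x by simp
    then show ?thesis
      apply -
      apply (rule fnI[OF program_nth(16)[unfolded test_body_def]])
         apply (simp add: length_program)
        apply (rule ev_intros ev_If_False fits_0 Z1 Z2 U I T fx f | assumption | simp)+
       apply (simp_all add: True bool_val_simps test_cost_def)
      done
  next
    case False
    then have "x \<le> 0" using x by simp
    then show ?thesis
      apply -
      apply (rule fnI[OF program_nth(16)[unfolded test_body_def]])
         apply (simp add: length_program)
        apply (rule ev_intros ev_If_True fits_0 Z1 Z2 U I T fx f | assumption | simp)+
       apply (simp_all add: False bool_val_simps test_cost_def)
      done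
  qed
qed

text \<open>Induction on the number of candidates \<open>m, ..., D\<close> that are left. Per
  candidate, 40 units pay for the operations around the test, and the final 10 pay for the check
  that ends the search.\<close>

lemma run_search:
  assumes T: "\<And>j. j \<le> D \<Longrightarrow> run t B 15 [VInt (int j), VInt (int t * int j + int D), rs] (bool_val (Q j)) C"
    and fits: "fits B (int t)" "fits B (int (t * D + D + 1))"
  shows "m \<le> D + 1 \<Longrightarrow> run t B 16 [VInt (int m), VInt (int D), rs]
    (bool_val (\<exists>j. m \<le> j \<and> j \<le> D \<and> Q j)) ((D + 1 - m) * (C + 40) + 10)"
proof (induction "D + 1 - m" arbitrary: m)
  case 0
  then have m: "m = D + 1" by simp
  have f: "fits B (int D)" "fits B (int m)" by (auto intro!: fits_mono[OF fits(2)] simp: m)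
  have ne: "\<not> int m \<le> int D" by (simp add: m)
  show ?case
    apply (rule fnI[OF program_nth(17)[unfolded search_body_def]])
       apply (simp add: length_program)
      apply (rule ev_intros ev_If_False f ne | simp)+
     apply (simp_all add: m bool_val_def)
    done
next
  case (Suc d)
  then have m: "m \<le> D" by simp
  have fit: "fits B (int j)" if "j \<le> t * D + D + 1" for j
    by (rule fits_mono[OF fits(2)]) (use that in \<open>simp only: abs_of_nat of_nat_le_iff\<close>)
  have "t * m \<le> t * D" using m by (rule mult_le_mono2)
  then have "fits B (int (t * m))" by (intro fit) linarith
  then have f: "fits B (int D)" "fits B (int m)" "fits B (int t * int m)" "fits B 1"
    using m fit[of D] fit[of m] fit[of 1] by (simp_all add: trans_le_add1 trans_le_add2)
  have le: "int m \<le> int D" using m by simp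
  have eq: "D + 1 - m = Suc (D + 1 - (m + 1))" using m by simp
  have cost: "(D + 1 - m) * (C + 40) = (D + 1 - (m + 1)) * (C + 40) + C + 40" unfolding eq by simp
  note Tm = T[OF m]
  show ?case
  proof (cases "Q m")
    case True
    then have ex: "\<exists>j. m \<le> j \<and> j \<le> D \<and> Q j" using m by blast
    have Tm': "run t B 15 [VInt (int m), VInt (int t * int m + int D), rs] (VInt 1) C"
      using Tm True by (simp add: bool_val_simps)
    show ?thesis
      apply (rule fnI[OF program_nth(17)[unfolded search_body_def]])
         apply (simp add: length_program)
        apply (rule ev_If_True)
             apply (rule ev_intros f le | simp)+
        apply (rule ev_If_False)
             apply (rule ev_intros fits_0 f fits(1) Tm' | simp)+
       apply (simp only: ex bool_val_simps simp_thms)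
       apply (use cost in linarith)
      done
  next
    case False
    have Tm': "run t B 15 [VInt (int m), VInt (int t * int m + int D), rs] (VInt 0) C"
      using Tm False by (simp add: bool_val_simps)
    have ex: "(\<exists>j. m \<le> j \<and> j \<le> D \<and> Q j) \<longleftrightarrow> (\<exists>j. m + 1 \<le> j \<and> j \<le> D \<and> Q j)"
      using False by (metis Suc_eq_plus1 Suc_leD le_antisym not_less_eq_eq)
    have IH: "run t B 16 [VInt (int m + 1), VInt (int D), rs]
       (bool_val (\<exists>j. m \<le> j \<and> j \<le> D \<and> Q j)) ((D + 1 - (m + 1)) * (C + 40) + 10)"
      using Suc.hyps(1)[of "m + 1"] Suc.hyps(2) m unfolding ex by (simp add: add.commute)
    show ?thesis
      apply (rule fnI[OF program_nth(17)[unfolded search_body_def]])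
         apply (simp add: length_program)
        apply (rule ev_If_True)
             apply (rule ev_intros f le | simp)+
        apply (rule ev_If_True)
             apply (rule ev_intros fits_0 f fits(1) Tm' | simp)+
       apply (rule ev_intros f IH | simp)+
       apply (use cost in simp)
      done
  qed
qed

section \<open>Covers as unions with a gain\<close>

definition gain_cover :: "nat \<Rightarrow> 'a set set \<Rightarrow> nat \<Rightarrow> nat \<Rightarrow> bool" where
  "gain_cover t S D m \<longleftrightarrow> (\<exists>Qs. length Qs = m \<and> set Qs \<subseteq> S \<and> t * m + D \<le> card (\<Union>(set Qs)))"

text \<open>A set of size at most \<open>t + 1\<close> has size at most \<open>t\<close> or arises
  from such a set by adding one element, so their number grows by a factor of at most
  \<open>card U + 1\<close>.\<close>

lemma card_small_subsets:
  assumes "finite U"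
  shows "card {A. A \<subseteq> U \<and> card A \<le> t} \<le> (card U + 1) ^ t"
proof (induction t)
  case 0
  have "{A. A \<subseteq> U \<and> card A \<le> 0} \<subseteq> {{}}" using assms by (auto dest: finite_subset)
  then have "card {A. A \<subseteq> U \<and> card A \<le> 0} \<le> card {{} :: 'a set}" by (intro card_mono) auto
  then show ?case by simp
next
  case (Suc t)
  let ?F = "\<lambda>t. {A. A \<subseteq> U \<and> card A \<le> t}"
  have fin: "finite (?F t)" using assms by simp
  have "?F (Suc t) \<subseteq> ?F t \<union> (\<lambda>(A, x). insert x A) ` (?F t \<times> U)"
  proof
    fix A assume A: "A \<in> ?F (Suc t)"
    show "A \<in> ?F t \<union> (\<lambda>(A, x). insert x A) ` (?F t \<times> U)"
    proof (cases "card A \<le> t")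
      case False
      then obtain x where x: "x \<in> A" by (metis card.empty equals0I le0)
      have "finite A" using A assms finite_subset by auto
      then have "A - {x} \<in> ?F t" "x \<in> U" "A = insert x (A - {x})" using A x by auto
      then show ?thesis by (intro UnI2 image_eqI[of _ _ "(A - {x}, x)"]) auto
    qed (use A in simp)
  qed
  then have "card (?F (Suc t)) \<le> card (?F t \<union> (\<lambda>(A, x). insert x A) ` (?F t \<times> U))"
    using fin assms by (intro card_mono) auto
  also have "\<dots> \<le> card (?F t) + card ((\<lambda>(A, x). insert x A) ` (?F t \<times> U))" by (rule card_Un_le)
  also have "\<dots> \<le> card (?F t) + card (?F t \<times> U)"
    by (intro add_left_mono card_image_le) (use fin assms in auto)
  also have "\<dots> = card (?F t) * (card U + 1)" by (simp add: card_cartesian_product)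
  also have "\<dots> \<le> (card U + 1) ^ t * (card U + 1)" using Suc by (rule mult_le_mono1)
  also have "\<dots> = (card U + 1) ^ Suc t" by simp
  finally show ?case .
qed

text \<open>A maximal collection of sets that each contribute more than \<open>t\<close> new elements either already
  has the required gain, or its union is a small set outside of which all members of the family
  have at most \<open>t\<close> elements.\<close>

lemma card_family_bound:
  assumes "finite U" "S \<subseteq> Pow U" "\<And>m. m \<le> D \<Longrightarrow> \<not> gain_cover t S D m"
  shows "card S \<le> 2 ^ ((t + 1) * D) * (card U + 1) ^ t"
proof -
  define ch where "ch g \<longleftrightarrow> (\<exists>Qs. length Qs = g \<and> set Qs \<subseteq> S \<and> (t + 1) * g \<le> card (\<Union>(set Qs)))" for g
  \<comment> \<open>The cap \<open>D\<close> guarantees that a greatest length exists and puts the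
    collection in the range of the assumption on gains.\<close>
  define g where "g = (GREATEST g. ch g \<and> g \<le> D)"
  have "ch 0" unfolding ch_def by (intro exI[of _ "[]"]) simp
  then have g: "ch g \<and> g \<le> D" unfolding g_def
    using GreatestI_nat[of "\<lambda>g. ch g \<and> g \<le> D" 0 D] by blast
  have max: "h \<le> g" if "ch h" "h \<le> D" for h
    unfolding g_def
    using that Greatest_le_nat[of "\<lambda>g. ch g \<and> g \<le> D" h D] by blast
  obtain Qs where Qs: "length Qs = g" "set Qs \<subseteq> S" "(t + 1) * g \<le> card (\<Union>(set Qs))"
    using g unfolding ch_def by blast
  define W where "W = \<Union>(set Qs)"
  have "W \<subseteq> U" using Qs(2) assms(2) by (auto simp: W_def)
  then have fin: "finite W" using assms(1) by (rule finite_subset)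
  have "\<not> t * g + D \<le> card W" using assms(3)[of g] g Qs(1,2) unfolding gain_cover_def W_def by blast
  then have W: "card W < t * g + D" by simp
  \<comment> \<open>Combining \<open>(t + 1) * g \<le> card W\<close> with the missing gain shows
    that the cap is not attained, so maximality forbids any extension by one set.\<close>
  then have "g < D" using Qs(3) by (simp add: W_def)
  have "t * g \<le> t * D" using g by simp
  moreover have "(t + 1) * D = t * D + D" by simp
  ultimately have cW: "card W \<le> (t + 1) * D" using W by linarith
  have small: "card (A - W) \<le> t" if A: "A \<in> S" for A
  proof (rule ccontr)
    assume *: "\<not> card (A - W) \<le> t"
    have finA: "finite A" using A assms(1,2) finite_subset by blast
    have "card (\<Union>(set (A # Qs))) = card (W \<union> (A - W))" by (simp add: W_def Un_commute)
    also have "\<dots> = card W + card (A - W)" using fin finA by (intro card_Un_disjoint) auto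
    finally have "(t + 1) * (g + 1) \<le> card (\<Union>(set (A # Qs)))"
      using * Qs(3) by (simp add: W_def)
    then have "ch (g + 1)" unfolding ch_def using A Qs(1,2) by (intro exI[of _ "A # Qs"]) auto
    with max[of "g + 1"] \<open>g < D\<close> show False by simp
  qed
  let ?F = "{A. A \<subseteq> U \<and> card A \<le> t}"
  \<comment> \<open>A set is determined by its trace on \<open>W\<close> and its remainder outside
    of \<open>W\<close>, and the remainder has at most \<open>t\<close> elements.\<close>
  have "inj_on (\<lambda>A. (A \<inter> W, A - W)) S" by (rule inj_onI) blast
  moreover have "(\<lambda>A. (A \<inter> W, A - W)) ` S \<subseteq> Pow W \<times> ?F"
  proof
    fix p assume "p \<in> (\<lambda>A. (A \<inter> W, A - W)) ` S"
    then obtain A where "A \<in> S" "p = (A \<inter> W, A - W)" by blast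
    with small[of A] assms(2) show "p \<in> Pow W \<times> ?F" by auto
  qed
  moreover have "finite (Pow W \<times> ?F)" using fin assms(1) by simp
  ultimately have "card S \<le> card (Pow W \<times> ?F)" by (rule card_inj_on_le)
  also have "\<dots> = 2 ^ card W * card ?F" using fin by (simp add: card_cartesian_product card_Pow)
  also have "\<dots> \<le> 2 ^ ((t + 1) * D) * (card U + 1) ^ t"
    using cW card_small_subsets[OF assms(1)] by (intro mult_le_mono power_increasing) auto
  finally show ?thesis .
qed

lemma gain_cover_small:
  assumes "finite U" "S \<subseteq> Pow U" "gain_cover t S D m"
  shows "\<exists>j\<le>D. gain_cover t S D j"
proof -
  define l where "l = (LEAST j. gain_cover t S D j)"
  have l: "gain_cover t S D l" unfolding l_def using assms(3) by (rule LeastI)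
  have least: "l \<le> j" if "gain_cover t S D j" for j unfolding l_def using that by (rule Least_le)
  obtain Qs where Qs: "length Qs = l" "set Qs \<subseteq> S" "t * l + D \<le> card (\<Union>(set Qs))"
    using l by (auto simp: gain_cover_def)
  have finU: "finite (\<Union>(set Q))" if "set Q \<subseteq> S" for Q
    using that assms(1,2) finite_subset[of "\<Union>(set Q)" U] by blast
  \<comment> \<open>Dropping a set with at most \<open>t\<close> private elements costs at most
    \<open>t\<close> elements of the union, so the gain \<open>D\<close> would survive with one set
    fewer, against minimality.\<close>
  have priv: "t < card (Qs ! i - \<Union>(set (take i Qs @ drop (Suc i) Qs)))" if i: "i < l" for i
  proof (rule ccontr)
    define Rs where "Rs = take i Qs @ drop (Suc i) Qs"
    assume "\<not> t < card (Qs ! i - \<Union>(set (take i Qs @ drop (Suc i) Qs)))"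
    then have le: "card (Qs ! i - \<Union>(set Rs)) \<le> t" by (simp add: Rs_def)
    have "set Qs = set (take i Qs @ Qs ! i # drop (Suc i) Qs)"
      using i Qs(1) by (simp flip: id_take_nth_drop)
    then have eq: "set Qs = insert (Qs ! i) (set Rs)" by (simp add: Rs_def)
    then have Rs: "set Rs \<subseteq> S" "Qs ! i \<in> S" using Qs(2) by auto
    have "\<Union>(set Qs) = \<Union>(set Rs) \<union> (Qs ! i - \<Union>(set Rs))" unfolding eq by auto
    then have "card (\<Union>(set Qs)) \<le> card (\<Union>(set Rs)) + card (Qs ! i - \<Union>(set Rs))"
      by (metis card_Un_le)
    with le Qs(3) have "t * l + D \<le> card (\<Union>(set Rs)) + t" by linarith
    moreover have "t * l = t * (l - 1) + t" using i by (cases l) auto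
    ultimately have "t * (l - 1) + D \<le> card (\<Union>(set Rs))" by linarith
    moreover have "length Rs = l - 1" using i Qs(1) by (simp add: Rs_def)
    ultimately have "gain_cover t S D (l - 1)" unfolding gain_cover_def using Rs(1) by blast
    with least[of "l - 1"] i show False by simp
  qed
  \<comment> \<open>Elements that are private among all sets are in particular new relative to the
    preceding ones.\<close>
  have prefix: "(t + 1) * i \<le> card (\<Union>(set (take i Qs)))" if "i \<le> l" for i
    using that
  proof (induction i)
    case (Suc i)
    have sub: "set (take i Qs) \<subseteq> S" "Qs ! i \<in> S"
      using Qs(1,2) Suc.prems set_take_subset[of i Qs] nth_mem[of i Qs] by auto
    have finA: "finite (Qs ! i)" using sub(2) assms(1,2) finite_subset by blast
    have "t < card (Qs ! i - \<Union>(set (take i Qs @ drop (Suc i) Qs)))" using priv[of i] Suc.prems by simp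
    also have "\<dots> \<le> card (Qs ! i - \<Union>(set (take i Qs)))" using finA by (intro card_mono) auto
    finally have p: "t + 1 \<le> card (Qs ! i - \<Union>(set (take i Qs)))" by simp
    have "\<Union>(set (take (Suc i) Qs)) = \<Union>(set (take i Qs)) \<union> (Qs ! i - \<Union>(set (take i Qs)))"
      using Suc.prems Qs(1) by (auto simp: take_Suc_conv_app_nth)
    moreover have "card (\<Union>(set (take i Qs)) \<union> (Qs ! i - \<Union>(set (take i Qs)))) =
        card (\<Union>(set (take i Qs))) + card (Qs ! i - \<Union>(set (take i Qs)))"
      using finA finU[OF sub(1)] by (intro card_Un_disjoint) auto
    ultimately show ?case using p Suc by simp
  qed simp
  show ?thesis
  proof (cases "l \<le> D")
    case False
    have "set (take D Qs) \<subseteq> S" using Qs(2) set_take_subset[of D Qs] by blast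
    moreover have "length (take D Qs) = D" using False Qs(1) by simp
    \<comment> \<open>Here \<open>(t + 1) * D\<close> is exactly what \<open>D\<close> sets need for
      the gain \<open>D\<close>.\<close>
    moreover have "t * D + D \<le> card (\<Union>(set (take D Qs)))" using prefix[of D] False by simp
    ultimately have "gain_cover t S D D" unfolding gain_cover_def by blast
    then show ?thesis by blast
  qed (use l in blast)
qed

text \<open>Each block consists of \<open>t\<close> elements of what is left, or of everything left
  together with arbitrary further elements of \<open>U\<close>; the latter is possible since
  \<open>t \<le> card U\<close>.\<close>

lemma cover_by_blocks:
  assumes "finite U" "t \<le> card U"
  shows "R \<subseteq> U \<Longrightarrow> card R \<le> t * p \<Longrightarrow>
    \<exists>Bs. length Bs = p \<and> set Bs \<subseteq> {A. A \<subseteq> U \<and> card A = t} \<and> R \<subseteq> \<Union>(set Bs)"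
proof (induction p arbitrary: R)
  case 0
  then have "R = {}" using assms(1) finite_subset by fastforce
  then show ?case by simp
next
  case (Suc p)
  have finR: "finite R" using Suc.prems assms(1) finite_subset by blast
  obtain B where B: "B \<subseteq> U" "card B = t" "card (R - B) \<le> t * p"
  proof (cases "card R \<le> t")
    case True
    then obtain B where "R \<subseteq> B" "B \<subseteq> U" "card B = t"
      using exists_subset_between[of R t U] Suc.prems assms by auto
    moreover from this have "R - B = {}" by blast
    ultimately show ?thesis using that[of B] by (metis card.empty le0)
  next
    case False
    then obtain B where B: "B \<subseteq> R" "card B = t"
      using obtain_subset_with_card_n[of t R] by (metis nat_le_linear)
    then have "card (R - B) \<le> t * p" using Suc.prems(2) finR by (simp add: card_Diff_subset finite_subset)
    then show ?thesis using that[of B] B Suc.prems(1) by blast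
  qed
  obtain Bs where "length Bs = p" "set Bs \<subseteq> {A. A \<subseteq> U \<and> card A = t}" "R - B \<subseteq> \<Union>(set Bs)"
    using Suc.IH[of "R - B"] B(3) Suc.prems(1) by blast
  then show ?case using B by (intro exI[of _ "B # Bs"]) auto
qed

text \<open>Identifies the residue computed by the program with the slack \<open>t * q - n\<close>
  of rounding up.\<close>

lemma ceiling_div_eq:
  assumes "1 \<le> t"
  shows "int t * \<lceil>real n / real t\<rceil> = int n + (- int n) mod int t"
proof -
  have "\<lceil>real n / real t\<rceil> = - (- int n div int t)"
    using ceiling_divide_eq_div[of "int n" "int t", where 'a = real] by simp
  moreover have "int t * (- int n div int t) + (- int n) mod int t = - int n"
    by (rule mult_div_mod_eq)
  ultimately show ?thesis by (simp only: mult_minus_right)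
qed

text \<open>The choice of \<open>D\<close> means \<open>t * (q - k) + D = n\<close>. A cover by at
  most \<open>q - k\<close> sets therefore has gain \<open>D\<close>; conversely, after sets with
  gain \<open>D\<close> the sets still available suffice to fill up with blocks of size
  \<open>t\<close>.\<close>

lemma has_set_cover_iff_gain_cover:
  assumes inst: "uniform_set_cover_instance t U S" and t: "1 \<le> t" and k: "1 \<le> k"
    and D: "int D = int t * k - (- int (card U)) mod int t"
  shows "has_set_cover_at_most U S (\<lceil>real (card U) / real t\<rceil> - k) \<longleftrightarrow> (\<exists>m. gain_cover t S D m)"
proof -
  define n where "n = card U"
  define q where "q = \<lceil>real n / real t\<rceil>"
  have inst': "finite U" "S \<subseteq> Pow U" "{A. A \<subseteq> U \<and> card A = t} \<subseteq> S"
    using inst by (auto simp: uniform_set_cover_instance_def)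
  have Dq: "int D = int t * k + int n - int t * q"
    using D ceiling_div_eq[OF t, of n] by (simp add: q_def n_def)
  show ?thesis
    unfolding n_def[symmetric] q_def[symmetric]
  proof
    assume "has_set_cover_at_most U S (q - k)"
    then obtain As where As: "set As \<subseteq> S" "int (length As) \<le> q - k" "\<Union>(set As) = U"
      by (auto simp: has_set_cover_at_most_def)
    have "int t * int (length As) \<le> int t * (q - k)" using As(2) by (intro mult_left_mono) auto
    then have "int (t * length As + D) \<le> int n" using Dq by (simp add: algebra_simps)
    then have "t * length As + D \<le> card (\<Union>(set As))" using As(3) by (simp only: of_nat_le_iff n_def)
    then show "\<exists>m. gain_cover t S D m" unfolding gain_cover_def using As(1) by blast
  next
    assume "\<exists>m. gain_cover t S D m"
    then obtain Qs where Qs: "set Qs \<subseteq> S" "t * length Qs + D \<le> card (\<Union>(set Qs))"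
      by (auto simp: gain_cover_def)
    define W where "W = \<Union>(set Qs)"
    define p where "p = q - k - int (length Qs)"
    have WU: "W \<subseteq> U" using Qs(1) inst'(2) by (auto simp: W_def)
    then have "card W \<le> n" using inst'(1) by (simp add: card_mono n_def)
    have "int t * int (length Qs) + int D \<le> int (card W)"
      using Qs(2) unfolding W_def by (simp flip: of_nat_mult of_nat_add)
    then have rem: "int n - int (card W) \<le> int t * p"
      by (simp add: Dq p_def algebra_simps)
    have "0 \<le> int t * p" using rem \<open>card W \<le> n\<close> by linarith
    \<comment> \<open>That the collection has at most \<open>q - k\<close> sets is not assumed: it
      follows from the gain, since the union has at most \<open>n\<close> elements.\<close>
    then have p: "0 \<le> p" using t by (simp add: zero_le_mult_iff)
    have cR: "card (U - W) = n - card W"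
      using WU inst'(1) finite_subset by (auto simp: n_def intro!: card_Diff_subset)
    have "\<exists>Bs. length Bs = nat p \<and> set Bs \<subseteq> S \<and> U - W \<subseteq> \<Union>(set Bs)"
    proof (cases "p = 0")
      case True
      then have "card (U - W) = 0" using rem cR by simp
      then have "U - W = {}" using inst'(1) by simp
      then show ?thesis using True by simp
    next
      case False
      \<comment> \<open>From \<open>p \<ge> 1\<close> and \<open>k \<ge> 1\<close> it follows that
        \<open>q \<ge> 2\<close>, hence \<open>n > t\<close>, so that blocks of size
        \<open>t\<close> exist at all.\<close>
      then have "2 \<le> q" using p k by (simp add: p_def)
      then have "1 < real n / real t" by (simp add: q_def le_ceiling_iff)
      then have "t \<le> n" using t by (simp add: field_simps)
      moreover have "card (U - W) \<le> t * nat p"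
      proof -
        have "int (card (U - W)) \<le> int (t * nat p)" using rem cR p \<open>card W \<le> n\<close> by simp
        then show ?thesis by (simp only: of_nat_le_iff)
      qed
      ultimately obtain Bs where "length Bs = nat p" "set Bs \<subseteq> {A. A \<subseteq> U \<and> card A = t}" "U - W \<subseteq> \<Union>(set Bs)"
        using cover_by_blocks[OF inst'(1), of t "U - W" "nat p"] by (auto simp: n_def)
      then show ?thesis using inst'(3) by blast
    qed
    then obtain Bs where Bs: "length Bs = nat p" "set Bs \<subseteq> S" "U - W \<subseteq> \<Union>(set Bs)" by blast
    have "\<Union>(set (Qs @ Bs)) = U" using Bs Qs(1) inst'(2) WU by (auto simp: W_def)
    moreover have "int (length (Qs @ Bs)) \<le> q - k" using Bs(1) p by (simp add: p_def)
    ultimately show "has_set_cover_at_most U S (q - k)"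
      unfolding has_set_cover_at_most_def using Bs(2) Qs(1) by (intro exI[of _ "Qs @ Bs"]) auto
  qed
qed

section \<open>Incidence rows as sets of positions\<close>

definition row :: "'a list \<Rightarrow> 'a set \<Rightarrow> bool list" where
  "row us A = map (\<lambda>u. u \<in> A) us"

lemma row_elems_row: "row_elems (row us A) x = (\<lambda>i. x + int i) ` {i. i < length us \<and> us ! i \<in> A}"
proof (induction us arbitrary: x)
  case (Cons u us)
  have "{i. i < length (u # us) \<and> (u # us) ! i \<in> A} =
      (if u \<in> A then {0} else {}) \<union> Suc ` {i. i < length us \<and> us ! i \<in> A}"
    by (auto simp: less_Suc_eq_0_disj)
  then show ?case using Cons by (auto simp: row_def image_image add.assoc)
qed (simp add: row_def)

text \<open>Since \<open>us\<close> is distinct and contains all elements of the union, positions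
  and elements correspond one to one.\<close>

lemma card_Union_row_elems:
  assumes "distinct us" "\<Union>Q \<subseteq> set us"
  shows "card (\<Union>A\<in>Q. row_elems (row us A) 0) = card (\<Union>Q)"
proof -
  have "(\<Union>A\<in>Q. row_elems (row us A) 0) = int ` {i. i < length us \<and> us ! i \<in> \<Union>Q}"
    by (auto simp: row_elems_row)
  then have "card (\<Union>A\<in>Q. row_elems (row us A) 0) = card {i. i < length us \<and> us ! i \<in> \<Union>Q}"
    by (simp add: card_image)
  also have "\<dots> = card ((!) us ` {i. i < length us \<and> us ! i \<in> \<Union>Q})"
    using assms(1) by (intro card_image[symmetric] inj_on_nth) auto
  also have "(!) us ` {i. i < length us \<and> us ! i \<in> \<Union>Q} = \<Union>Q"
  proof (intro equalityI subsetI)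
    fix u assume u: "u \<in> \<Union>Q"
    then obtain i where "i < length us" "us ! i = u" using assms(2) by (metis in_set_conv_nth subsetD)
    with u show "u \<in> (!) us ` {i. i < length us \<and> us ! i \<in> \<Union>Q}" by blast
  qed auto
  finally show ?thesis .
qed

lemma union_test_rows:
  assumes "distinct us" "set As \<subseteq> Pow (set us)"
  shows "union_test (map (row us) As) m k \<longleftrightarrow>
    (\<exists>Qs. length Qs = m \<and> set Qs \<subseteq> set As \<and> k \<le> card (\<Union>(set Qs)))"
proof
  assume "union_test (map (row us) As) m k"
  then obtain rs where rs: "length rs = m" "set rs \<subseteq> row us ` set As" "k \<le> card (\<Union>r\<in>set rs. row_elems r 0)"
    by (auto simp: union_test_def)
  \<comment> \<open>Preimages of the rows under \<open>row us\<close> are chosen entry by entry,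
    giving a list of sets of the same length.\<close>
  from rs(2) have "rs \<in> lists (row us ` set As)" by (simp add: in_lists_conv_set subset_iff)
  then obtain Qs where Qs: "rs = map (row us) Qs" "set Qs \<subseteq> set As" by (auto simp: lists_image in_lists_conv_set)
  have "\<Union>(set Qs) \<subseteq> set us" using Qs(2) assms(2) by blast
  from card_Union_row_elems[OF assms(1) this] rs Qs
  show "\<exists>Qs. length Qs = m \<and> set Qs \<subseteq> set As \<and> k \<le> card (\<Union>(set Qs))"
    by (intro exI[of _ Qs]) simp
next
  assume "\<exists>Qs. length Qs = m \<and> set Qs \<subseteq> set As \<and> k \<le> card (\<Union>(set Qs))"
  then obtain Qs where Qs: "length Qs = m" "set Qs \<subseteq> set As" "k \<le> card (\<Union>(set Qs))" by blast
  have "\<Union>(set Qs) \<subseteq> set us" using Qs(2) assms(2) by blast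
  from card_Union_row_elems[OF assms(1) this] Qs
  show "union_test (map (row us) As) m k"
    unfolding union_test_def by (intro exI[of _ "map (row us) Qs"]) auto
qed

section \<open>Running times\<close>

text \<open>The runs of the subroutines enter as hypotheses. \<open>SR\<close> is demanded only if
  the list is not too long, because the cost of the search depends on the number of rows.\<close>

lemma run_main_pos:
  fixes rv :: val
  assumes k: "1 \<le> k" and D: "int D = int t * k - (- int n) mod int t"
    and fits: "fits B k" "fits B (int t)" "fits B (int t * k)" "fits B ((- int n) mod int t)"
      "fits B (int t + 1)" "fits B (int D)" "fits B (2 ^ ((t + 1) * D))" "fits B ((int n + 1) ^ t)" "fits B (int n)" "fits B 1"
    and NM: "run t B 14 [VInt (int n)] (VInt ((- int n) mod int t)) u1"
    and P1: "run t B 12 [VInt 2, VInt (int ((t + 1) * D))] (VInt (2 ^ ((t + 1) * D))) u2"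
    and P2: "run t B 12 [VInt (int n + 1), VInt (int t)] (VInt ((int n + 1) ^ t)) u3"
    and LG: "run t B 13 [VInt (int L), rv] (bool_val longer) u4"
    and L: "L = 2 ^ ((t + 1) * D) * (n + 1) ^ t"
    and SR: "\<not> longer \<Longrightarrow> run t B 16 [VInt 0, VInt (int D), rv] (bool_val found) u5"
  shows "run t B 0 [VCons (VInt k) (VCons (VInt (int n)) (VCons rv VNil))] (bool_val (longer \<or> found))
    (u1 + u2 + u3 + u4 + u5 + 60)"
proof -
  have EVD: "ev (set_cover_program t) B [rv, VNil, VInt (int n), VCons rv VNil, VInt k, x, y]
      (ESub (EMul (EInt (int t)) (EVar 4)) (ECall 14 [EVar 2])) (VInt (int D)) (u1 + 6)" for x y
    apply (rule ev_eq)
      apply (rule ev_intros NM fits | simp)+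
     apply (simp_all add: D)
    done
  have Dt: "(int t + 1) * int D = int ((t + 1) * D)" by (simp add: algebra_simps)
  have EVT: "ev (set_cover_program t) B (VInt (int D) # env)
      (EMul (EInt (int t + 1)) (EVar 0)) (VInt (int ((t + 1) * D))) 3" for env
    apply (rule ev_eq)
      apply (rule ev_intros fits | simp)+
     apply (simp_all only: Dt)
    apply simp
    done
  have LL: "int L = 2 ^ ((t + 1) * D) * (int n + 1) ^ t" by (simp add: L add.commute)
  have EVL: "ev (set_cover_program t) B [VInt (int D), rv, VNil, VInt (int n), VCons rv VNil, VInt k, x, y]
      (EMul (ECall 12 [EInt 2, EMul (EInt (int t + 1)) (EVar 0)]) (ECall 12 [EAdd (EVar 3) (EInt 1), EInt (int t)]))
      (VInt (int L)) (u2 + u3 + 11)" for x y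
    apply (rule ev_eq)
      apply (rule EVT ev_intros P1 P2 fits | simp)+
     apply (simp_all add: LL)
    done
  have k0: "\<not> k \<le> 0" using k by simp
  show ?thesis
  proof (cases longer)
    case True
    then have LG': "run t B 13 [VInt (int L), rv] (VInt 1) u4" using LG by (simp add: bool_val_simps)
    show ?thesis
      apply (rule fnI[OF program_nth(1)[unfolded main_body_def]])
         apply (simp add: length_program)
        apply (rule ev_straight | (simp; fail))+
        apply (rule ev_If_False)
             apply (rule ev_straight fits fits_0 k0 | (simp; fail))+
        apply (rule ev_Let)
         apply (rule EVD)
        apply (rule ev_If_False)
             apply (rule EVL ev_straight LG' fits fits_0 | (simp; fail))+
       apply (simp_all add: True bool_val_simps)
      done
  next
    case False
    then have LG': "run t B 13 [VInt (int L), rv] (VInt 0) u4" using LG by (simp add: bool_val_simps)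
    show ?thesis
      apply (rule fnI[OF program_nth(1)[unfolded main_body_def]])
         apply (simp add: length_program)
        apply (rule ev_straight | (simp; fail))+
        apply (rule ev_If_False)
             apply (rule ev_straight fits fits_0 k0 | (simp; fail))+
        apply (rule ev_Let)
         apply (rule EVD)
        apply (rule ev_If_True)
             apply (rule EVL ev_straight LG' fits fits_0 SR[OF False] | (simp; fail))+
       apply (simp_all add: False)
      done
  qed
qed

section \<open>Bounds of the form \<open>2 ^ O(k) * poly(n)\<close>\<close>

definition fpt :: "(nat \<Rightarrow> nat \<Rightarrow> nat) \<Rightarrow> bool" where
  "fpt f \<longleftrightarrow> (\<exists>c. \<forall>k n. f k n \<le> c * 2 ^ (c * k) * (n + 1) ^ c)"

text \<open>Factor, exponent and degree may be given separately: their sum serves as the common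
  constant.\<close>

lemma fptI: "(\<And>k n. f k n \<le> a * 2 ^ (b * k) * (n + 1) ^ d) \<Longrightarrow> fpt f"
  unfolding fpt_def
proof (intro exI allI)
  fix k n assume f: "\<And>k n. f k n \<le> a * 2 ^ (b * k) * (n + 1) ^ d"
  show "f k n \<le> (a + b + d) * 2 ^ ((a + b + d) * k) * (n + 1) ^ (a + b + d)"
    by (rule order_trans[OF f]) (intro mult_le_mono power_increasing; simp)
qed

lemma fpt_const: "fpt (\<lambda>k n. a)"
  by (rule fptI[of _ a 0 0]) simp

lemma fpt_param: "fpt (\<lambda>k n. k)"
  by (rule fptI[of _ 1 1 0]) (simp add: less_imp_le[OF less_exp])

lemma fpt_size: "fpt (\<lambda>k n. n)"
  by (rule fptI[of _ 1 0 1]) simp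

lemma fpt_exp: "fpt (\<lambda>k n. 2 ^ (a * k))"
  by (rule fptI[of _ 1 a 0]) simp

lemma fpt_mult:
  assumes "fpt f" "fpt g" shows "fpt (\<lambda>k n. f k n * g k n)"
proof -
  obtain a b where f: "\<And>k n. f k n \<le> a * 2 ^ (a * k) * (n + 1) ^ a"
    and g: "\<And>k n. g k n \<le> b * 2 ^ (b * k) * (n + 1) ^ b"
    using assms unfolding fpt_def by blast
  have eq: "a * 2 ^ (a * k) * (n + 1) ^ a * (b * 2 ^ (b * k) * (n + 1) ^ b) =
      a * b * 2 ^ ((a + b) * k) * (n + 1) ^ (a + b)" for k n :: nat
  proof -
    have "(2::nat) ^ ((a + b) * k) = 2 ^ (a * k) * 2 ^ (b * k)" by (simp add: power_add distrib_right)
    then show ?thesis by (simp add: power_add mult_ac)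
  qed
  show ?thesis
    by (rule fptI[of _ "a * b" "a + b" "a + b"], rule order_trans[OF mult_le_mono[OF f g]], simp only: eq)
qed

lemma fpt_add:
  assumes "fpt f" "fpt g" shows "fpt (\<lambda>k n. f k n + g k n)"
proof -
  obtain a b where f: "\<And>k n. f k n \<le> a * 2 ^ (a * k) * (n + 1) ^ a"
    and g: "\<And>k n. g k n \<le> b * 2 ^ (b * k) * (n + 1) ^ b"
    using assms unfolding fpt_def by blast
  show ?thesis
  proof (rule fptI)
    fix k n
    have "f k n \<le> a * (2 ^ ((a + b) * k) * (n + 1) ^ (a + b))"
      by (rule order_trans[OF f]) (unfold mult.assoc, intro mult_le_mono power_increasing; simp)
    moreover have "g k n \<le> b * (2 ^ ((a + b) * k) * (n + 1) ^ (a + b))"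
      by (rule order_trans[OF g]) (unfold mult.assoc, intro mult_le_mono power_increasing; simp)
    ultimately show "f k n + g k n \<le> (a + b) * 2 ^ ((a + b) * k) * (n + 1) ^ (a + b)"
      unfolding distrib_right mult.assoc by linarith
  qed
qed

lemma fpt_power: "fpt f \<Longrightarrow> fpt (\<lambda>k n. f k n ^ a)"
proof (induction a)
  case 0
  then show ?case using fpt_const[of 1] by simp
next
  case (Suc a)
  from fpt_mult[OF Suc.prems Suc.IH[OF Suc.prems]] show ?case by simp
qed

section \<open>Closed forms of the cost functions\<close>

lemma lincomb_cost_le: "lincomb_cost d \<le> 28 * 2 ^ d"
proof -
  have "lincomb_cost d + 19 = 28 * 2 ^ d" by (induction d) auto
  then show ?thesis by simp
qed

text \<open>The recurrence grows like \<open>d * 2 ^ d\<close>; the base 3 absorbs the factor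
  \<open>d\<close>.\<close>

lemma wedge_cost_le: "wedge_cost d \<le> 44 * 3 ^ d"
proof (induction d)
  case (Suc d)
  have "lincomb_cost d \<le> 28 * 3 ^ d"
    using lincomb_cost_le[of d] power_mono[of 2 "3::nat" d] by linarith
  moreover have "1 \<le> (3::nat) ^ d" by simp
  ultimately have "16 + 2 * wedge_cost d + lincomb_cost d \<le> 132 * 3 ^ d" using Suc by linarith
  then show ?case by simp
qed simp

lemma inner_cost_le: "inner_cost k n \<le> (wedge_cost n + 18) * 2 ^ k"
proof -
  have "inner_cost k n + 13 = (wedge_cost n + 18) * 2 ^ k" by (induction k) auto
  then show ?thesis by simp
qed

lemma dpowers_cost_eq: "dpowers_cost k = 3 + 12 * k" by (induction k) auto
lemma zero_cost_eq: "zero_cost k = 3 + 10 * k" by (induction k) auto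
lemma top_cost_eq: "top_cost k = 3 + 10 * k" by (induction k) auto
lemma zeros_cost_eq: "zeros_cost k = 4 + 12 * k" by (induction k) auto
lemma power_cost_eq: "power_cost k = 4 + 13 * k" by (induction k) auto
lemma longer_cost_eq: "longer_cost k = 10 + 14 * k" by (induction k) auto
lemma neg_mod_cost_eq: "neg_mod_cost k = 8 + 12 * k" by (induction k) auto

lemma one_cost_le: "one_cost d \<le> 20 * 2 ^ d"
proof (induction d)
  case (Suc d)
  have "13 + 10 * d \<le> 20 * 2 ^ d"
  proof (induction d)
    case (Suc d)
    have "1 \<le> (2::nat) ^ d" by simp
    with Suc show ?case by simp
  qed simp
  with Suc show ?case by (simp add: zero_cost_eq)
qed simp

declare ext_cost.simps [simp del]

text \<open>The base 9 is \<open>3 ^ 2\<close>, from the wedge product on all \<open>2 * k\<close>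
  coordinates, and dominates the other terms.\<close>

lemma ext_cost_le: "ext_cost k \<le> 214 * 9 ^ k"
proof -
  have pow: "(2::nat) ^ (2 * k) = 4 ^ k" "(3::nat) ^ (2 * k) = 9 ^ k" by (simp_all add: power_mult)
  have le: "(4::nat) ^ k \<le> 9 ^ k" "(2::nat) ^ k \<le> 9 ^ k" "(6::nat) ^ k \<le> 9 ^ k" "(1::nat) \<le> 9 ^ k"
    by (simp_all add: power_mono)
  have "k < 2 ^ k" by (rule less_exp)
  then have k: "k \<le> 9 ^ k" using le by linarith
  have "inner_cost k k \<le> (44 * 3 ^ k + 18) * 2 ^ k"
    using inner_cost_le[of k k] wedge_cost_le[of k] mult_le_mono1 order_trans by (meson add_le_mono1)
  also have "\<dots> = 44 * 6 ^ k + 18 * 2 ^ k" by (simp add: add_mult_distrib flip: power_mult_distrib)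
  finally have "inner_cost k k \<le> 62 * 9 ^ k" using le by linarith
  moreover have "lincomb_cost (2 * k) \<le> 28 * 9 ^ k"
    using lincomb_cost_le[of "2 * k", unfolded pow] le(1) by linarith
  moreover have "wedge_cost (2 * k) \<le> 44 * 9 ^ k"
    using wedge_cost_le[of "2 * k", unfolded pow] .
  moreover have "56 + 24 * k \<le> 80 * 9 ^ k" using k le(4) by linarith
  moreover have "ext_cost k = inner_cost k k + lincomb_cost (2 * k) + wedge_cost (2 * k) + (56 + 24 * k)"
    by (simp add: ext_cost.simps dpowers_cost_eq)
  ultimately show ?thesis by linarith
qed

lemma row_cost_eq: "row_cost k n = 3 + n * ext_cost k"
  by (induction n) auto

lemma row_cost_le: "row_cost k n \<le> 217 * 9 ^ k * (n + 1)"
proof -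
  have "n * ext_cost k \<le> n * (214 * 9 ^ k)" using ext_cost_le by (intro mult_le_mono2)
  moreover have "217 * 9 ^ k * (n + 1) = 3 * (n * 9 ^ k) + n * (214 * 9 ^ k) + 217 * 9 ^ k" by simp
  moreover define p where "p = (9::nat) ^ k"
  moreover have "1 \<le> p" by (simp add: p_def)
  ultimately show ?thesis unfolding row_cost_eq by linarith
qed

lemma rows_cost_eq:
  "rows_cost k n R = 6 + zero_cost (2 * k) + R * (24 + lincomb_cost (2 * k) + row_cost k n)"
  by (induction R) auto

lemma nine_power_ge: "1 \<le> (9::nat) ^ k" "k \<le> 9 ^ k" "(4::nat) ^ k \<le> 9 ^ k"
proof -
  show "k \<le> 9 ^ k" using less_exp[of k] power_mono[of 2 "9::nat" k] by linarith
qed (simp_all add: power_mono)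

lemma rows_cost_le: "rows_cost k n R \<le> 269 * 9 ^ k * (n + 1) * (R + 1)"
proof -
  define E where "E = (9::nat) ^ k * (n + 1)"
  have E9: "9 ^ k \<le> E" by (simp add: E_def)
  then have E: "1 \<le> E" "k \<le> E" using order_trans[OF nine_power_ge(1) E9] order_trans[OF nine_power_ge(2) E9]
    by blast+
  have "lincomb_cost (2 * k) \<le> 28 * 9 ^ k"
    using lincomb_cost_le[of "2 * k"] nine_power_ge(3)[of k] by (simp add: power_mult)
  moreover have "row_cost k n \<le> 217 * E" using row_cost_le[of k n] by (simp only: E_def mult.assoc)
  ultimately have "24 + lincomb_cost (2 * k) + row_cost k n \<le> 269 * E"
    using E E9 by linarith
  then have "R * (24 + lincomb_cost (2 * k) + row_cost k n) \<le> R * (269 * E)" by (rule mult_le_mono2)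
  moreover have "6 + zero_cost (2 * k) \<le> 269 * E"
    using E E9 unfolding zero_cost_eq by linarith
  moreover have "269 * E * (R + 1) = R * (269 * E) + 269 * E" by simp
  ultimately have "rows_cost k n R \<le> 269 * E * (R + 1)" unfolding rows_cost_eq by linarith
  then show ?thesis by (simp only: E_def mult.assoc)
qed

lemma iterate_cost_eq: "iterate_cost k n R m = 6 + m * (26 + rows_cost k n R)"
  by (induction m) auto

lemma test_cost_le: "test_cost k n R m \<le> 442 * 9 ^ k * (n + 1) * (R + 1) * (m + 1)"
proof -
  define E where "E = (9::nat) ^ k * (n + 1) * (R + 1)"
  have E9: "9 ^ k \<le> E" by (simp add: E_def)
  then have E: "1 \<le> E" "k \<le> E" using order_trans[OF nine_power_ge(1) E9] order_trans[OF nine_power_ge(2) E9]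
    by blast+
  have "rows_cost k n R \<le> 269 * E" using rows_cost_le[of k n R] by (simp only: E_def mult.assoc)
  then have "26 + rows_cost k n R \<le> 295 * E" using E E9 by linarith
  then have "m * (26 + rows_cost k n R) \<le> m * (295 * E)" by (rule mult_le_mono2)
  moreover have "one_cost (2 * k) \<le> 20 * 9 ^ k"
    using one_cost_le[of "2 * k"] nine_power_ge(3)[of k] by (simp add: power_mult)
  moreover have "442 * E * (m + 1) = 147 * (m * E) + m * (295 * E) + 442 * E" by simp
  ultimately have "test_cost k n R m \<le> 442 * E * (m + 1)"
    unfolding test_cost_def iterate_cost_eq zeros_cost_eq top_cost_eq
    using E E9 by linarith
  then show ?thesis by (simp only: E_def mult.assoc)
qed

section \<open>Bit lengths of the intermediate integers\<close>

lemma fits_of_nat: "x \<le> B \<Longrightarrow> fits B (int x)"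
proof -
  assume "x \<le> B"
  have "x < 2 ^ x" by (rule less_exp)
  also have "\<dots> \<le> 2 ^ B" using \<open>x \<le> B\<close> by (intro power_increasing) auto
  finally show ?thesis unfolding fits_def abs_of_nat by (metis of_nat_less_iff of_nat_numeral of_nat_power)
qed

lemma fits_le_power: "x \<le> 2 ^ e \<Longrightarrow> e < B \<Longrightarrow> fits B (int x)"
proof -
  assume "x \<le> 2 ^ e" "e < B"
  moreover have "(2::nat) ^ e < 2 ^ B" using \<open>e < B\<close> by simp
  ultimately have "x < 2 ^ B" by linarith
  then show ?thesis unfolding fits_def abs_of_nat by (metis of_nat_less_iff of_nat_numeral of_nat_power)
qed

lemma Suc_le_power: "n + 1 \<le> 2 ^ n"
  using less_exp[of n] by linarith

text \<open>A binary exponent for the coefficients after \<open>m\<close> rounds: each round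
  contributes \<open>e\<close> for the number of rows and \<open>2 * k + 2 * n * k + 3\<close> for
  each of the \<open>n\<close> entries of a row. It is polynomial in its arguments.\<close>

definition digits :: "nat \<Rightarrow> nat \<Rightarrow> nat \<Rightarrow> nat \<Rightarrow> nat" where
  "digits m k n e = m * (e + n * (2 * k + 2 * n * k + 3))"

lemma digits_mono: "m \<le> m' \<Longrightarrow> k \<le> k' \<Longrightarrow> digits m k n e \<le> digits m' k' n e"
  unfolding digits_def by (intro mult_le_mono add_le_mono) auto

lemma growth_power_le:
  assumes "R + 1 \<le> 2 ^ e"
  shows "((int R + 1) * growth k n (int n + 1)) ^ m \<le> 2 ^ digits m k n e"
proof -
  define X where "X = int n + 1"
  have "int (n + 1) \<le> int (2 ^ n)" using Suc_le_power of_nat_le_iff by blast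
  \<comment> \<open>The crude estimate \<open>n + 1 \<le> 2 ^ n\<close> is affordable because bit
    lengths need only be polynomial.\<close>
  then have X: "0 \<le> X" "X \<le> 2 ^ n" by (simp_all add: X_def)
  have "X ^ k \<le> (2 ^ n) ^ k" using X by (intro power_mono) auto
  moreover have k: "int k \<le> 2 ^ k" using less_exp[of k] by (simp add: le_less flip: of_nat_less_iff)
  ultimately have "int k * X ^ k \<le> 2 ^ k * (2 ^ n) ^ k" using X by (intro mult_mono) auto
  also have "\<dots> = 2 ^ (k + n * k)" by (simp add: power_add power_mult)
  finally have "vec_bound k X \<le> 1 + 2 ^ (k + n * k)" by (simp add: vec_bound_def)
  also have "\<dots> \<le> 2 ^ (k + n * k) + 2 ^ (k + n * k)" by (intro add_right_mono) simp
  also have "\<dots> = 2 ^ (k + n * k + 1)" by simp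
  finally have V: "vec_bound k X \<le> 2 ^ (k + n * k + 1)" .
  have "0 \<le> vec_bound k X" using X by (simp add: vec_bound_def)
  then have "(vec_bound k X)\<^sup>2 \<le> (2 ^ (k + n * k + 1))\<^sup>2" using V by (intro power_mono) auto
  also have "\<dots> = 2 ^ (2 * k + 2 * n * k + 2)" unfolding power_mult[symmetric] by (simp add: algebra_simps)
  finally have "(vec_bound k X)\<^sup>2 \<le> 2 ^ (2 * k + 2 * n * k + 2)" .
  from add_mono[OF one_le_power this, of 2 "2 * k + 2 * n * k + 2"]
  have "1 + (vec_bound k X)\<^sup>2 \<le> 2 ^ (2 * k + 2 * n * k + 2) + 2 ^ (2 * k + 2 * n * k + 2)"
    by simp
  also have "\<dots> = 2 ^ (2 * k + 2 * n * k + 3)" by (simp add: numeral_3_eq_3)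
  finally have "growth k n X \<le> (2 ^ (2 * k + 2 * n * k + 3)) ^ n"
    unfolding growth_def by (intro power_mono) auto
  moreover have "int R + 1 \<le> 2 ^ e"
  proof -
    have "int (R + 1) \<le> int (2 ^ e)" using assms of_nat_le_iff by blast
    then show ?thesis by simp
  qed
  ultimately have "(int R + 1) * growth k n X \<le> 2 ^ e * (2 ^ (2 * k + 2 * n * k + 3)) ^ n"
    using growth_ge[of k n X] by (intro mult_mono) auto
  then have "((int R + 1) * growth k n X) ^ m \<le> (2 ^ e * (2 ^ (2 * k + 2 * n * k + 3)) ^ n) ^ m"
    using growth_ge[of k n X] by (intro power_mono) auto
  also have "\<dots> = 2 ^ digits m k n e"
    unfolding power_mult[symmetric] power_add[symmetric] digits_def by (simp add: mult.commute)
  finally show ?thesis by (simp add: X_def)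
qed

text \<open>Provides one cost bound and one word size \<open>B\<close> for all tests of a search, in
  terms of upper bounds for \<open>m\<close>, \<open>k\<close> and the number of rows.\<close>

lemma run_test_uniform:
  assumes "\<forall>r\<in>set rows. length r = n" "m \<le> m'" "k \<le> k'" "length rows + 1 \<le> R" "R \<le> 2 ^ e"
    and B: "digits m' k' n e + n + m' + 2 * k' + 2 \<le> B"
  shows "run t B 15 [VInt (int m), VInt (int k), rows_val rows] (bool_val (union_test rows m k))
    (442 * 2 ^ (4 * k') * (n + 1) * R * (m' + 1))"
proof (rule fn_eq)
  have X: "fits B (int n + 1)"
  proof -
    have "fits B (int (n + 1))" by (rule fits_of_nat) (use B in linarith)
    then show ?thesis by (simp add: add.commute)
  qed
  have "((int (length rows) + 1) * growth k n (int n + 1)) ^ m \<le> 2 ^ digits m k n e"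
    using assms(4,5) by (intro growth_power_le) linarith
  also have "\<dots> \<le> 2 ^ digits m' k' n e" using digits_mono[OF assms(2,3)] by (intro power_increasing) auto
  also have "\<dots> < 2 ^ B" using B by (intro power_strict_increasing) auto
  finally have "fits B (((int (length rows) + 1) * growth k n (int n + 1)) ^ m)"
    using growth_ge[of k n "int n + 1"] by (simp add: fits_def)
  then show "run t B 15 [VInt (int m), VInt (int k), rows_val rows] (bool_val (union_test rows m k))
      (test_cost k n (length rows) m)"
    using assms(2,3) B X by (intro run_test[OF assms(1), of "int n + 1"] fits_of_nat) auto
  have "(9::nat) ^ k \<le> 16 ^ k'" using assms(3) power_increasing[of k k' "9::nat"] power_mono[of 9 "16::nat" k'] by linarith
  also have "(16::nat) ^ k' = 2 ^ (4 * k')" by (simp add: power_mult)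
  finally have "442 * 9 ^ k * (n + 1) * (length rows + 1) * (m + 1) \<le> 442 * 2 ^ (4 * k') * (n + 1) * R * (m' + 1)"
    using assms(2,4) by (intro mult_le_mono) auto
  with test_cost_le show "test_cost k n (length rows) m \<le> 442 * 2 ^ (4 * k') * (n + 1) * R * (m' + 1)"
    by (rule order_trans)
qed simp

lemma runs_within_run:
  assumes "run t B 0 [x] y u" "(u + 2) * unit_cost B \<le> T"
  shows "runs_within (set_cover_program t) x y T"
proof -
  have "ev (set_cover_program t) B [x] (ECall 0 [EVar 0]) y (1 + 0 + 1 + u)"
    by (rule ev_Call[OF _ assms(1)]) (rule evs_Cons ev_Var evs_Nil | simp)+
  then obtain c where "c \<le> (1 + 0 + 1 + u) * unit_cost B" "eval (set_cover_program t) [x] (ECall 0 [EVar 0]) y c"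
    unfolding ev_def by blast
  then show ?thesis unfolding runs_within_def using assms(2) by (intro exI[of _ c]) auto
qed

lemma encode_input_eq:
  "encode_input us As k = VCons (VInt k) (VCons (VInt (int (length us))) (VCons (rows_val (map (row us) As)) VNil))"
  by (simp add: encode_input_def row_def o_def)

section \<open>Positive parameters\<close>

definition max_rows :: "nat \<Rightarrow> nat \<Rightarrow> nat \<Rightarrow> nat" where
  "max_rows t k n = 2 ^ ((t + 1) * t * k) * (n + 1) ^ t"

text \<open>Inside \<open>digits\<close>, \<open>t * k\<close> bounds the number of sets,
  \<open>(t + 1) * t * k\<close> the sizes of the tested unions, and the last argument is the
  exponent of a power of two above \<open>max_rows t k n\<close>.\<close>

definition pos_bits :: "nat \<Rightarrow> nat \<Rightarrow> nat \<Rightarrow> nat" where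
  "pos_bits t k n = digits (t * k) ((t + 1) * t * k) n ((t + 1) * t * k + n * t + 1) + n * t
     + n + t * k + 3 * ((t + 1) * t * k) + k + t + 5"

definition pos_cost :: "nat \<Rightarrow> nat \<Rightarrow> nat \<Rightarrow> nat" where
  "pos_cost t k n = neg_mod_cost n + (4 + 13 * ((t + 1) * t * k)) + power_cost t + (10 + 14 * max_rows t k n)
     + ((t * k + 1) * (442 * 2 ^ (4 * ((t + 1) * t * k)) * (n + 1) * (max_rows t k n + 1) * (t * k + 1) + 40) + 10) + 62"

lemma fpt_pos: "fpt (\<lambda>k n. pos_cost t k n * unit_cost (pos_bits t k n))"
proof -
  have "4 * ((t + 1) * t * k) = (4 * ((t + 1) * t)) * k" for k by simp
  then show ?thesis
    unfolding pos_cost_def pos_bits_def unit_cost_def max_rows_def digits_def neg_mod_cost_eq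
    by (simp only:) (intro fpt_const fpt_param fpt_size fpt_exp fpt_add fpt_mult fpt_power)
qed

lemma runs_within_pos:
  assumes inst: "uniform_set_cover_instance t U S" "enumerates us U" "enumerates As S" and t: "1 \<le> t" and k: "1 \<le> k"
  shows "runs_within (set_cover_program t) (encode_input us As (int k))
    (bool_val (has_set_cover_at_most U S (\<lceil>real (card U) / real t\<rceil> - int k)))
    (pos_cost t k (card U) * unit_cost (pos_bits t k (card U)))"
proof -
  define n where "n = card U"
  have us: "distinct us" "set us = U" "length us = n" and As: "distinct As" "set As = S" "length As = card S"
    using inst(2,3) by (auto simp: enumerates_def n_def distinct_card)
  have U: "finite U" "S \<subseteq> Pow U" using inst(1) by (auto simp: uniform_set_cover_instance_def)
  define slack where "slack = (- int n) mod int t"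
  have sl: "0 \<le> slack" "slack < int t" using t by (auto simp: slack_def)
  define D where "D = t * k - nat slack"
  have "t * 1 \<le> t * k" using k by (intro mult_le_mono2)
  then have "nat slack \<le> t * k" using sl by linarith
  \<comment> \<open>Truncated subtraction is harmless, as the slack is below \<open>t\<close> and
    hence at most \<open>t * k\<close>.\<close>
  then have D: "int D = int t * int k - slack" using sl by (simp add: D_def of_nat_diff)
  have Dk: "D \<le> t * k" by (simp add: D_def)
  define K where "K = (t + 1) * t * k"
  have tD: "(t + 1) * D \<le> K" using Dk by (simp add: K_def mult.assoc del: mult_Suc)
  define L where "L = 2 ^ ((t + 1) * D) * (n + 1) ^ t"
  have LM: "L \<le> max_rows t k n"
    unfolding L_def max_rows_def K_def[symmetric]
    by (rule mult_le_mono[OF power_increasing[OF tD] le_refl]) simp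
  define e where "e = K + n * t + 1"
  have nt: "(n + 1) ^ t \<le> 2 ^ (n * t)" unfolding power_mult using Suc_le_power by (intro power_mono) auto
  have "max_rows t k n \<le> 2 ^ K * 2 ^ (n * t)"
    unfolding max_rows_def K_def[symmetric] using nt by (rule mult_le_mono2)
  then have M: "max_rows t k n \<le> 2 ^ (K + n * t)" by (simp add: power_add)
  moreover have "1 \<le> (2::nat) ^ (K + n * t)" by simp
  ultimately have "max_rows t k n + 1 \<le> 2 ^ (K + n * t) + 2 ^ (K + n * t)" by (rule add_mono)
  also have "\<dots> = 2 ^ e" by (simp add: e_def)
  finally have M1: "max_rows t k n + 1 \<le> 2 ^ e" .
  define B where "B = pos_bits t k n"
  have B: "B = digits (t * k) K n e + n * t + n + t * k + 3 * K + k + t + 5"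
    by (simp add: B_def pos_bits_def K_def e_def)
  define rows where "rows = map (row us) As"
  have rows: "\<forall>r\<in>set rows. length r = n" "length rows = card S"
    using us As by (auto simp: rows_def row_def)
  define C where "C = 442 * 2 ^ (4 * K) * (n + 1) * (max_rows t k n + 1) * (t * k + 1)"
  define found where "found \<longleftrightarrow> (\<exists>j. 0 \<le> j \<and> j \<le> D \<and> union_test rows j (t * j + D))"
  have test_iff: "union_test rows j (t * j + D) \<longleftrightarrow> gain_cover t S D j" for j
    unfolding rows_def gain_cover_def
    using union_test_rows[OF us(1), of As j "t * j + D"] us(2) As(2) U(2) by simp
  have answer: "has_set_cover_at_most U S (\<lceil>real n / real t\<rceil> - int k) \<longleftrightarrow> L < length rows \<or> found"
  proof -
    have "has_set_cover_at_most U S (\<lceil>real n / real t\<rceil> - int k) \<longleftrightarrow> (\<exists>j. gain_cover t S D j)"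
      using has_set_cover_iff_gain_cover[OF inst(1) t, of "int k" D] k D by (simp add: n_def slack_def)
    also have "\<dots> \<longleftrightarrow> (\<exists>j\<le>D. gain_cover t S D j)"
      using gain_cover_small[OF U] by blast
    also have "\<dots> \<longleftrightarrow> found" by (auto simp: found_def test_iff)
    \<comment> \<open>A list longer than \<open>L\<close> contradicts
      \<open>card_family_bound\<close> unless a gain exists, so accepting it unread does not change
      the answer.\<close>
    also have "found \<longleftrightarrow> L < length rows \<or> found"
      using card_family_bound[OF U, of D t] unfolding found_def test_iff rows(2) L_def n_def
      by (meson le0 not_le)
    finally show ?thesis .
  qed
  have fits: "fits B (int t)" "fits B (int D)" "fits B (int n)" "fits B (int k)" "fits B (int (t * k))"
      "fits B (int (t + 1))" "fits B (int ((t + 1) * D))" "fits B (int (t * D + D + 1))" "fits B (int 1)" "fits B (int (n + 1))"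
      "fits B (int 2)"
    by (rule fits_of_nat, use Dk tD in \<open>simp add: B\<close>)+
  have fL: "fits B (int L)" "fits B (int (2 ^ ((t + 1) * D)))" "fits B (int ((n + 1) ^ t))"
  proof -
    show "fits B (int L)" by (rule fits_le_power[OF order_trans[OF LM M]]) (simp add: B)
    show "fits B (int (2 ^ ((t + 1) * D)))"
      by (rule fits_le_power[OF le_refl]) (use tD in \<open>simp add: B\<close>)
    show "fits B (int ((n + 1) ^ t))" by (rule fits_le_power[OF nt]) (simp add: B)
  qed
  have fs: "fits B slack" using sl by (intro fits_le[OF fits(1)]) auto
  have NM: "run t B 14 [VInt (int n)] (VInt slack) (neg_mod_cost n)"
    using run_neg_mod[OF t fits(1), of "int n" n] fits(3) t by (simp add: slack_def)
  have P1: "run t B 12 [VInt 2, VInt (int ((t + 1) * D))] (VInt (2 ^ ((t + 1) * D))) (power_cost ((t + 1) * D))"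
    using fits(7) fL(2) by (intro run_power) simp_all
  have P2: "run t B 12 [VInt (int n + 1), VInt (int t)] (VInt ((int n + 1) ^ t)) (power_cost t)"
    using fits(1) fL(3) by (intro run_power) (simp_all add: add.commute)
  have LG: "run t B 13 [VInt (int L), rows_val rows] (bool_val (L < length rows)) (longer_cost L)"
    using run_longer[OF fL(1), of t "map (\<lambda>r. list_val (map bool_val r)) rows"] fits(9) by simp
  have SR: "run t B 16 [VInt 0, VInt (int D), rows_val rows] (bool_val found) ((D + 1) * (C + 40) + 10)"
    if "\<not> L < length rows"
  proof -
    have T: "run t B 15 [VInt (int j), VInt (int t * int j + int D), rows_val rows]
        (bool_val (union_test rows j (t * j + D))) C" if j: "j \<le> D" for j
    proof -
      have "t * j + D \<le> (t + 1) * D" using j by simp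
      then have "t * j + D \<le> K" using tD by linarith
      \<comment> \<open>The failed length check is what bounds the number of rows in terms of
        \<open>k\<close> and \<open>n\<close>.\<close>
      moreover have "length rows + 1 \<le> max_rows t k n + 1" using \<open>\<not> L < length rows\<close> LM by simp
      ultimately have "run t B 15 [VInt (int j), VInt (int (t * j + D)), rows_val rows]
        (bool_val (union_test rows j (t * j + D))) C"
        unfolding C_def using j Dk M1 by (intro run_test_uniform[OF rows(1)]) (auto simp: B)
      then show ?thesis by simp
    qed
    from run_search[OF T fits(1,8), of 0] show ?thesis by (simp add: found_def)
  qed
  have "run t B 0 [VCons (VInt (int k)) (VCons (VInt (int n)) (VCons (rows_val rows) VNil))]
     (bool_val (L < length rows \<or> found))
     (neg_mod_cost n + power_cost ((t + 1) * D) + power_cost t + longer_cost L + ((D + 1) * (C + 40) + 10) + 60)"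
  proof (rule run_main_pos[OF _ _ fits(4,1) _ _ _ fits(2) _ _ fits(3) _ _ P1 P2 LG L_def SR])
    show "run t B 14 [VInt (int n)] (VInt (- int n mod int t)) (neg_mod_cost n)" using NM by (simp add: slack_def)
  qed (use k D fits fs fL in \<open>simp_all add: slack_def add.commute\<close>)
  then have R: "run t B 0 [encode_input us As (int k)] (bool_val (L < length rows \<or> found))
     (neg_mod_cost n + power_cost ((t + 1) * D) + power_cost t + longer_cost L + ((D + 1) * (C + 40) + 10) + 60)"
    by (simp add: encode_input_eq us(3) rows_def)
  have "power_cost ((t + 1) * D) \<le> 4 + 13 * K" using tD unfolding power_cost_eq by linarith
  moreover have "longer_cost L \<le> 10 + 14 * max_rows t k n" using LM unfolding longer_cost_eq by linarith
  moreover have "(D + 1) * (C + 40) \<le> (t * k + 1) * (C + 40)" using Dk by (intro mult_le_mono1) simp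
  ultimately have "neg_mod_cost n + power_cost ((t + 1) * D) + power_cost t + longer_cost L
      + ((D + 1) * (C + 40) + 10) + 60 + 2 \<le> pos_cost t k n"
    unfolding pos_cost_def K_def[symmetric] C_def[symmetric] by linarith
  then show ?thesis
    using runs_within_run[OF R] answer unfolding n_def[symmetric] B_def by (simp add: mult_le_mono1)
qed

section \<open>Nonpositive parameters\<close>

lemma run_main_nonpos:
  assumes k: "k \<le> 0" and fits: "fits B k" "fits B (int t)" "fits B (int n)" "fits B 1"
    and T: "0 < n \<Longrightarrow> n < t \<Longrightarrow> run t B 15 [VInt (1 - k), VInt (int n), rv] (bool_val found) u"
  shows "run t B 0 [VCons (VInt k) (VCons (VInt (int n)) (VCons rv VNil))]
    (bool_val (t \<le> n \<or> n = 0 \<or> found)) (u + 40)"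
proof (cases "t \<le> n")
  case True
  then have le: "int t \<le> int n" by simp
  show ?thesis
    apply (rule fnI[OF program_nth(1)[unfolded main_body_def]])
       apply (simp add: length_program)
      apply (rule ev_straight | (simp; fail))+
      apply (rule ev_If_True)
           apply (rule ev_straight fits fits_0 k | (simp; fail))+
      apply (rule ev_If_True)
           apply (rule ev_straight fits fits_0 le | (simp; fail))+
     apply (simp_all add: True bool_val_simps)
    done
next
  case False
  then have nle: "\<not> int t \<le> int n" by simp
  show ?thesis
  proof (cases "n = 0")
    case True
    then have le: "int n \<le> 0" by simp
    show ?thesis
      apply (rule fnI[OF program_nth(1)[unfolded main_body_def]])
         apply (simp add: length_program)
        apply (rule ev_straight | (simp; fail))+
        apply (rule ev_If_True)
             apply (rule ev_straight fits fits_0 k | (simp; fail))+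
        apply (rule ev_If_False)
             apply (rule ev_straight fits fits_0 nle | (simp; fail))+
        apply (rule ev_If_True)
             apply (rule ev_straight fits fits_0 le | (simp; fail))+
       apply (simp_all add: True bool_val_simps)
      done
  next
    case n: False
    then have nz: "\<not> int n \<le> 0" by simp
    have T': "run t B 15 [VInt (1 - k), VInt (int n), rv] (bool_val found) u"
      using T n False by simp
    show ?thesis
      apply (rule fnI[OF program_nth(1)[unfolded main_body_def]])
         apply (simp add: length_program)
        apply (rule ev_straight | (simp; fail))+
        apply (rule ev_If_True)
             apply (rule ev_straight fits fits_0 k | (simp; fail))+
        apply (rule ev_If_False)
             apply (rule ev_straight fits fits_0 nle | (simp; fail))+
        apply (rule ev_If_False)
             apply (rule ev_straight fits fits_0 nz T' | (simp; fail))+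
       apply (simp_all add: False n)
      done
  qed
qed

text \<open>If \<open>t \<le> n\<close>, blocks of size \<open>t\<close> alone give a cover by
  \<open>\<lceil>n/t\<rceil>\<close> sets; the empty universe is covered by the empty list.\<close>

lemma has_set_cover_nonpos:
  assumes inst: "uniform_set_cover_instance t U S" and t: "1 \<le> t" and k: "k \<le> 0"
    and n: "t \<le> card U \<or> card U = 0"
  shows "has_set_cover_at_most U S (\<lceil>real (card U) / real t\<rceil> - k)"
proof -
  have U: "finite U" "{A. A \<subseteq> U \<and> card A = t} \<subseteq> S" using inst by (auto simp: uniform_set_cover_instance_def)
  show ?thesis
  proof (cases "card U = 0")
    case True
    then have "U = {}" using U(1) by simp
    then show ?thesis using k unfolding has_set_cover_at_most_def by (intro exI[of _ "[]"]) simp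
  next
    case False
    define q where "q = \<lceil>real (card U) / real t\<rceil>"
    have q0: "0 \<le> q" using ceiling_mono[of 0 "real (card U) / real t"] by (simp add: q_def)
    have "0 \<le> (- int (card U)) mod int t" using t by simp
    then have "int (card U) \<le> int t * q" using ceiling_div_eq[OF t, of "card U"] unfolding q_def by linarith
    also have "\<dots> = int (t * nat q)" using q0 by simp
    finally have "card U \<le> t * nat q" by (simp only: of_nat_le_iff)
    then obtain Bs where Bs: "length Bs = nat q" "set Bs \<subseteq> {A. A \<subseteq> U \<and> card A = t}" "U \<subseteq> \<Union>(set Bs)"
      using cover_by_blocks[OF U(1), of t U "nat q"] n False by auto
    have "set Bs \<subseteq> S" using Bs(2) U(2) by blast
    moreover have "\<Union>(set Bs) = U" using Bs(2,3) by blast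
    moreover have "int (length Bs) \<le> q - k" using Bs(1) q0 k by simp
    ultimately show ?thesis unfolding has_set_cover_at_most_def q_def by blast
  qed
qed

text \<open>Here the ceiling is 1. A shorter cover is nonempty and can be padded with copies of a
  member to length exactly \<open>k + 1\<close>, as the union test requires.\<close>

lemma has_set_cover_small_universe:
  assumes U: "finite U" "S \<subseteq> Pow U" and n: "0 < card U" "card U < t"
  shows "has_set_cover_at_most U S (\<lceil>real (card U) / real t\<rceil> + int k) \<longleftrightarrow>
    (\<exists>Qs. length Qs = k + 1 \<and> set Qs \<subseteq> S \<and> card U \<le> card (\<Union>(set Qs)))"
proof -
  have "\<lceil>real (card U) / real t\<rceil> = 1"
    using n by (intro ceiling_unique) (auto simp: field_simps)
  then have "has_set_cover_at_most U S (\<lceil>real (card U) / real t\<rceil> + int k) \<longleftrightarrow>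
      (\<exists>As. set As \<subseteq> S \<and> length As \<le> k + 1 \<and> \<Union>(set As) = U)"
    unfolding has_set_cover_at_most_def by (auto simp: nat_le_iff)
  also have "\<dots> \<longleftrightarrow> (\<exists>Qs. length Qs = k + 1 \<and> set Qs \<subseteq> S \<and> card U \<le> card (\<Union>(set Qs)))"
  proof
    assume "\<exists>As. set As \<subseteq> S \<and> length As \<le> k + 1 \<and> \<Union>(set As) = U"
    then obtain As where As: "set As \<subseteq> S" "length As \<le> k + 1" "\<Union>(set As) = U" by blast
    have "As \<noteq> []" using As(3) n(1) by auto
    then obtain A where A: "A \<in> set As" by (cases As) auto
    define Qs where "Qs = As @ replicate (k + 1 - length As) A"
    have "set Qs = set As" using A by (auto simp: Qs_def)
    moreover have "length Qs = k + 1" using As(2) by (simp add: Qs_def)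
    ultimately show "\<exists>Qs. length Qs = k + 1 \<and> set Qs \<subseteq> S \<and> card U \<le> card (\<Union>(set Qs))"
      using As by (intro exI[of _ Qs]) simp
  next
    assume "\<exists>Qs. length Qs = k + 1 \<and> set Qs \<subseteq> S \<and> card U \<le> card (\<Union>(set Qs))"
    then obtain Qs where Qs: "length Qs = k + 1" "set Qs \<subseteq> S" "card U \<le> card (\<Union>(set Qs))" by blast
    have "\<Union>(set Qs) \<subseteq> U" using Qs(2) U(2) by blast
    then have "\<Union>(set Qs) = U" using Qs(3) U(1) by (intro card_seteq)
    then show "\<exists>As. set As \<subseteq> S \<and> length As \<le> k + 1 \<and> \<Union>(set As) = U"
      using Qs by (intro exI[of _ Qs]) simp
  qed
  finally show ?thesis .
qed

definition nonpos_bits :: "nat \<Rightarrow> nat \<Rightarrow> nat \<Rightarrow> nat" where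
  "nonpos_bits t k n = digits (k + 1) t n (t + 1) + n + k + 2 * t + 3"

definition nonpos_cost :: "nat \<Rightarrow> nat \<Rightarrow> nat \<Rightarrow> nat" where
  "nonpos_cost t k n = 442 * 2 ^ (4 * t) * (n + 1) * (2 ^ t + 1) * (k + 2) + 42"

lemma fpt_nonpos: "fpt (\<lambda>k n. nonpos_cost t k n * unit_cost (nonpos_bits t k n))"
  unfolding nonpos_cost_def nonpos_bits_def unit_cost_def digits_def
  by (intro fpt_const fpt_param fpt_size fpt_exp fpt_add fpt_mult fpt_power)

lemma runs_within_nonpos:
  assumes inst: "uniform_set_cover_instance t U S" "enumerates us U" "enumerates As S" and t: "1 \<le> t"
  shows "runs_within (set_cover_program t) (encode_input us As (- int k))
    (bool_val (has_set_cover_at_most U S (\<lceil>real (card U) / real t\<rceil> + int k)))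
    (nonpos_cost t k (card U) * unit_cost (nonpos_bits t k (card U)))"
proof -
  define n where "n = card U"
  have us: "distinct us" "set us = U" "length us = n" and As: "distinct As" "set As = S" "length As = card S"
    using inst(2,3) by (auto simp: enumerates_def n_def distinct_card)
  have U: "finite U" "S \<subseteq> Pow U" using inst(1) by (auto simp: uniform_set_cover_instance_def)
  define B where "B = nonpos_bits t k n"
  define rows where "rows = map (row us) As"
  have rows: "\<forall>r\<in>set rows. length r = n" "length rows = card S"
    using us As by (auto simp: rows_def row_def)
  define found where "found \<longleftrightarrow> union_test rows (k + 1) n"
  define C where "C = 442 * 2 ^ (4 * t) * (n + 1) * (2 ^ t + 1) * (k + 2)"
  have fits: "fits B (int k)" "fits B (int t)" "fits B (int n)" "fits B (int 1)"
    by (rule fits_of_nat, simp add: B_def nonpos_bits_def)+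
  have T: "run t B 15 [VInt (1 - - int k), VInt (int n), rows_val rows] (bool_val found) C" if "n < t"
  proof -
    \<comment> \<open>The family has no more than \<open>2 ^ n\<close> members, and
      \<open>n < t\<close> makes this a constant.\<close>
    have "card S \<le> card (Pow U)" using U by (intro card_mono) auto
    also have "\<dots> \<le> 2 ^ t" using U(1) \<open>n < t\<close> by (simp add: card_Pow n_def)
    finally have R: "length rows + 1 \<le> 2 ^ t + 1" by (simp add: rows)
    have R': "(2::nat) ^ t + 1 \<le> 2 ^ (t + 1)" by simp
    have "run t B 15 [VInt (int (k + 1)), VInt (int n), rows_val rows] (bool_val found)
        (442 * 2 ^ (4 * t) * (n + 1) * (2 ^ t + 1) * ((k + 1) + 1))"
      unfolding found_def
      by (rule run_test_uniform[OF rows(1) _ _ R R']) (use \<open>n < t\<close> in \<open>simp_all add: B_def nonpos_bits_def\<close>)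
    then show ?thesis by (simp add: C_def add.commute)
  qed
  have answer: "has_set_cover_at_most U S (\<lceil>real n / real t\<rceil> + int k) \<longleftrightarrow> t \<le> n \<or> n = 0 \<or> found"
  proof (cases "t \<le> n \<or> n = 0")
    case True
    then show ?thesis using has_set_cover_nonpos[OF inst(1) t, of "- int k"] by (auto simp: n_def)
  next
    case False
    then show ?thesis
      using has_set_cover_small_universe[OF U, of t k] union_test_rows[OF us(1), of As "k + 1" n] U(2) us(2) As(2)
      by (simp add: found_def rows_def n_def)
  qed
  have "run t B 0 [VCons (VInt (- int k)) (VCons (VInt (int n)) (VCons (rows_val rows) VNil))]
      (bool_val (t \<le> n \<or> n = 0 \<or> found)) (C + 40)"
    by (rule run_main_nonpos[OF _ _ fits(2,3) _ T]) (use fits in \<open>simp_all add: fits_def\<close>)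
  then have R: "run t B 0 [encode_input us As (- int k)] (bool_val (t \<le> n \<or> n = 0 \<or> found)) (C + 40)"
    by (simp add: encode_input_eq us(3) rows_def)
  have "C + 40 + 2 = nonpos_cost t k n" by (simp add: nonpos_cost_def C_def)
  with runs_within_run[OF R order_refl] show ?thesis
    unfolding n_def[symmetric] B_def answer by (simp only:)
qed

theorem theorem6:
  fixes t :: nat
  assumes "t \<ge> 1"
  shows "\<exists>(P :: program) (c :: nat).
    \<forall>(U :: nat set) S (k :: int) us As.
      uniform_set_cover_instance t U S \<longrightarrow> enumerates us U \<longrightarrow> enumerates As S \<longrightarrow>
      runs_within P (encode_input us As k)
        (bool_val (has_set_cover_at_most U S (\<lceil>real (card U) / real t\<rceil> - k)))
        (c * 2 ^ (c * nat \<bar>k\<bar>) * (card U + 1) ^ c)"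
proof -
  \<comment> \<open>The sum of the two bounds yields one constant for both signs of the
    parameter.\<close>
  obtain c where c: "\<And>k n. pos_cost t k n * unit_cost (pos_bits t k n)
      + nonpos_cost t k n * unit_cost (nonpos_bits t k n) \<le> c * 2 ^ (c * k) * (n + 1) ^ c"
    using fpt_add[OF fpt_pos fpt_nonpos, of t t] unfolding fpt_def by blast
  have mono: "runs_within P x y T'" if "runs_within P x y T" "T \<le> T'" for P x y T T'
    using that unfolding runs_within_def by (meson order_trans)
  show ?thesis
  proof (intro exI[of _ "set_cover_program t"] exI[of _ c] allI impI)
    fix U :: "nat set" and S and k :: int and us As
    assume inst: "uniform_set_cover_instance t U S" "enumerates us U" "enumerates As S"
    show "runs_within (set_cover_program t) (encode_input us As k)
        (bool_val (has_set_cover_at_most U S (\<lceil>real (card U) / real t\<rceil> - k)))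
        (c * 2 ^ (c * nat \<bar>k\<bar>) * (card U + 1) ^ c)"
    proof (cases "1 \<le> k")
      case True
      then have "runs_within (set_cover_program t) (encode_input us As k)
        (bool_val (has_set_cover_at_most U S (\<lceil>real (card U) / real t\<rceil> - k)))
        (pos_cost t (nat \<bar>k\<bar>) (card U) * unit_cost (pos_bits t (nat \<bar>k\<bar>) (card U)))"
        using runs_within_pos[OF inst assms, of "nat k"] by simp
      then show ?thesis by (rule mono) (use c[of "nat \<bar>k\<bar>" "card U"] in linarith)
    next
      case False
      then have "runs_within (set_cover_program t) (encode_input us As k)
        (bool_val (has_set_cover_at_most U S (\<lceil>real (card U) / real t\<rceil> - k)))
        (nonpos_cost t (nat \<bar>k\<bar>) (card U) * unit_cost (nonpos_bits t (nat \<bar>k\<bar>) (card U)))"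
        using runs_within_nonpos[OF inst assms, of "nat (- k)"] by simp
      then show ?thesis by (rule mono) (use c[of "nat \<bar>k\<bar>" "card U"] in linarith)
    qed
  qed
qed

end
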